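(* Let $A$ be a Vidinli algebra over a field $\mathbb{F}$ of characteristic not $2$, with norm $q$ and bilinear form $B$, and let $V=\{x\in A\mid q(x,1)=0\}$. Then the group scheme of automorphisms of $A$ is isomorphic, by restriction to $V$, to the group scheme of isometries of $B|_V$.
   Context: Algebras are not necessarily associative: an algebra over a field $\mathbb{F}$ is a vector space with a bilinear multiplication. Write $[x,y]=xy-yx$. For a quadratic form $q$, its polar form is denoted by the same letter: $q(x,y)=q(x+y)-q(x)-q(y)$. A conic algebra is a unital algebra $A$ (unity $1$) endowed with a quadratic form $q\colon A\to\mathbb{F}$, called the norm, such that $q(1)=1$ and $x^2-q(x,1)x+q(x)1=0$ for all $x\in A$. A Vidinli algebra is a conic algebra $A$ such that $[A,A]\subseteq\mathbb{F}1$. For a Vidinli algebra $A$ with norm $q$ over a field of characteristic not $2$, let $\omega\colon A\times A\to\mathbb{F}$ be the skew-symmetric bilinear form with $[x,y]=\omega(x,y)1$. The bilinear form of the Vidinli algebra is $B\colon A\times A\to\mathbb{F}$, $B(x,y)=\frac12\bigl(q(x,y)-\omega(x,y)\bigr)$. Moreover $A=\mathbb{F}1\oplus V$. Group schemes are viewed as group-valued functors on unital commutative associative $\mathbb{F}$-algebras $R$: the group scheme of automorphisms of $A$ is $R\mapsto \operatorname{Aut}_R(A\otimes_{\mathbb{F}}R)$ ($R$-algebra automorphisms), and the group scheme of isometries of $B|_V$ is $R\mapsto\{g\in \operatorname{GL}_R(V\otimes_{\mathbb{F}}R)\mid B_R(g(x),g(y))=B_R(x,y)\ \forall x,y\in V\otimes_{\mathbb{F}}R\}$,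 where $B_R$ is the $R$-bilinear extension of $B|_V$. *)

theory Defs
  imports "HOL-Algebra.Module" "HOL-Algebra.Bij" "HOL-Algebra.Free_Abelian_Groups"
    "HOL-Algebra.Generated_Groups"
begin

section \<open>Bilinear and quadratic forms\<close>

definition bilinear_form ::
  "('f, 'm) ring_scheme \<Rightarrow> ('f, 'a, 'n) module_scheme \<Rightarrow> ('a \<Rightarrow> 'a \<Rightarrow> 'f) \<Rightarrow> bool"
  where "bilinear_form F M b \<longleftrightarrow>
    (\<forall>x\<in>carrier M. \<forall>y\<in>carrier M. b x y \<in> carrier F) \<and>
    (\<forall>x\<in>carrier M. \<forall>y\<in>carrier M. \<forall>z\<in>carrier M.
       b (x \<oplus>\<^bsub>M\<^esub> y) z = b x z \<oplus>\<^bsub>F\<^esub> b y z \<and> b x (y \<oplus>\<^bsub>M\<^esub> z) = b x y \<oplus>\<^bsub>F\<^esub> b x z) \<and>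
    (\<forall>c\<in>carrier F. \<forall>x\<in>carrier M. \<forall>y\<in>carrier M.
       b (c \<odot>\<^bsub>M\<^esub> x) y = c \<otimes>\<^bsub>F\<^esub> b x y \<and> b x (c \<odot>\<^bsub>M\<^esub> y) = c \<otimes>\<^bsub>F\<^esub> b x y)"

definition polar ::
  "('f, 'm) ring_scheme \<Rightarrow> ('f, 'a, 'n) module_scheme \<Rightarrow> ('a \<Rightarrow> 'f) \<Rightarrow> 'a \<Rightarrow> 'a \<Rightarrow> 'f"
  where "polar F M q x y = q (x \<oplus>\<^bsub>M\<^esub> y) \<ominus>\<^bsub>F\<^esub> q x \<ominus>\<^bsub>F\<^esub> q y"

definition quadratic_form ::
  "('f, 'm) ring_scheme \<Rightarrow> ('f, 'a, 'n) module_scheme \<Rightarrow> ('a \<Rightarrow> 'f) \<Rightarrow> bool"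
  where "quadratic_form F M q \<longleftrightarrow>
    (\<forall>x\<in>carrier M. q x \<in> carrier F) \<and>
    (\<forall>c\<in>carrier F. \<forall>x\<in>carrier M. q (c \<odot>\<^bsub>M\<^esub> x) = c \<otimes>\<^bsub>F\<^esub> c \<otimes>\<^bsub>F\<^esub> q x) \<and>
    bilinear_form F M (polar F M q)"


section \<open>Conic and Vidinli algebras\<close>

text \<open>
  Algebras need not be associative, so they are \<open>module\<close> records whose \<open>mult\<close> field is only
  required to be bilinear; the library locale \<open>algebra\<close> (commutative, associative, unital)
  is used below for the scalar extensions.
\<close>

locale nonassoc_algebra = module F A + F?: field F for F (structure) and A (structure) +
  assumes amult_closed:
      "\<lbrakk>x \<in> carrier A; y \<in> carrier A\<rbrakk> \<Longrightarrow> x \<otimes>\<^bsub>A\<^esub> y \<in> carrier A"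
    and amult_l_distr:
      "\<lbrakk>x \<in> carrier A; y \<in> carrier A; z \<in> carrier A\<rbrakk> \<Longrightarrow>
       (x \<oplus>\<^bsub>A\<^esub> y) \<otimes>\<^bsub>A\<^esub> z = x \<otimes>\<^bsub>A\<^esub> z \<oplus>\<^bsub>A\<^esub> y \<otimes>\<^bsub>A\<^esub> z"
    and amult_r_distr:
      "\<lbrakk>x \<in> carrier A; y \<in> carrier A; z \<in> carrier A\<rbrakk> \<Longrightarrow>
       x \<otimes>\<^bsub>A\<^esub> (y \<oplus>\<^bsub>A\<^esub> z) = x \<otimes>\<^bsub>A\<^esub> y \<oplus>\<^bsub>A\<^esub> x \<otimes>\<^bsub>A\<^esub> z"
    and amult_smult_l:
      "\<lbrakk>c \<in> carrier F; x \<in> carrier A; y \<in> carrier A\<rbrakk> \<Longrightarrow>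
       (c \<odot>\<^bsub>A\<^esub> x) \<otimes>\<^bsub>A\<^esub> y = c \<odot>\<^bsub>A\<^esub> (x \<otimes>\<^bsub>A\<^esub> y)"
    and amult_smult_r:
      "\<lbrakk>c \<in> carrier F; x \<in> carrier A; y \<in> carrier A\<rbrakk> \<Longrightarrow>
       x \<otimes>\<^bsub>A\<^esub> (c \<odot>\<^bsub>A\<^esub> y) = c \<odot>\<^bsub>A\<^esub> (x \<otimes>\<^bsub>A\<^esub> y)"

locale conic_algebra = nonassoc_algebra F A for F (structure) and A (structure)
    and q :: "_ \<Rightarrow> _" +
  assumes unity_closed: "\<one>\<^bsub>A\<^esub> \<in> carrier A"
    and unity_l: "x \<in> carrier A \<Longrightarrow> \<one>\<^bsub>A\<^esub> \<otimes>\<^bsub>A\<^esub> x = x"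
    and unity_r: "x \<in> carrier A \<Longrightarrow> x \<otimes>\<^bsub>A\<^esub> \<one>\<^bsub>A\<^esub> = x"
    and norm_quadratic: "quadratic_form F A q"
    and norm_unity: "q \<one>\<^bsub>A\<^esub> = \<one>\<^bsub>F\<^esub>"
    and conic_identity: "x \<in> carrier A \<Longrightarrow>
       x \<otimes>\<^bsub>A\<^esub> x \<ominus>\<^bsub>A\<^esub> polar F A q x \<one>\<^bsub>A\<^esub> \<odot>\<^bsub>A\<^esub> x \<oplus>\<^bsub>A\<^esub> q x \<odot>\<^bsub>A\<^esub> \<one>\<^bsub>A\<^esub> = \<zero>\<^bsub>A\<^esub>"

definition commutator :: "('a, 'm) ring_scheme \<Rightarrow> 'a \<Rightarrow> 'a \<Rightarrow> 'a"
  where "commutator A x y = x \<otimes>\<^bsub>A\<^esub> y \<ominus>\<^bsub>A\<^esub> y \<otimes>\<^bsub>A\<^esub> x"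

locale vidinli_algebra = conic_algebra +
  assumes commutator_scalar:
    "\<lbrakk>x \<in> carrier A; y \<in> carrier A\<rbrakk> \<Longrightarrow> \<exists>c\<in>carrier F. commutator A x y = c \<odot>\<^bsub>A\<^esub> \<one>\<^bsub>A\<^esub>"

definition vidinli_omega ::
  "('f, 'm) ring_scheme \<Rightarrow> ('f, 'a, 'n) module_scheme \<Rightarrow> 'a \<Rightarrow> 'a \<Rightarrow> 'f"
  where "vidinli_omega F A x y = (THE c. c \<in> carrier F \<and> commutator A x y = c \<odot>\<^bsub>A\<^esub> \<one>\<^bsub>A\<^esub>)"

definition vidinli_form ::
  "('f, 'm) ring_scheme \<Rightarrow> ('f, 'a, 'n) module_scheme \<Rightarrow> ('a \<Rightarrow> 'f) \<Rightarrow> 'a \<Rightarrow> 'a \<Rightarrow> 'f"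
  where "vidinli_form F A q x y =
    inv\<^bsub>F\<^esub> (\<one>\<^bsub>F\<^esub> \<oplus>\<^bsub>F\<^esub> \<one>\<^bsub>F\<^esub>) \<otimes>\<^bsub>F\<^esub> (polar F A q x y \<ominus>\<^bsub>F\<^esub> vidinli_omega F A x y)"

text \<open>
  The subspace \<open>V\<close> inherits all fields of \<open>A\<close>.  It is not closed under multiplication and
  does not contain the unity; only its vector space structure is meaningful.
\<close>

definition trace_zero ::
  "('f, 'm) ring_scheme \<Rightarrow> ('f, 'a) module \<Rightarrow> ('a \<Rightarrow> 'f) \<Rightarrow> ('f, 'a) module"
  where "trace_zero F A q =
    A\<lparr>carrier := {x \<in> carrier A. polar F A q x \<one>\<^bsub>A\<^esub> = \<zero>\<^bsub>F\<^esub>}\<rparr>"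


section \<open>Tensor products\<close>

text \<open>
  \<open>M \<otimes>\<^sub>F R\<close> as the free abelian group on \<open>M \<times> R\<close> modulo the usual relations; the group is
  written multiplicatively, as in the library.
\<close>

definition tensor_relations ::
  "('f, 'm) ring_scheme \<Rightarrow> ('f, 'a, 'n) module_scheme \<Rightarrow> ('f, 'r, 'k) module_scheme \<Rightarrow>
   (('a \<times> 'r) \<Rightarrow>\<^sub>0 int) set"
  where "tensor_relations F M R =
    {frag_of (x \<oplus>\<^bsub>M\<^esub> y, r) - frag_of (x, r) - frag_of (y, r) | x y r.
       x \<in> carrier M \<and> y \<in> carrier M \<and> r \<in> carrier R} \<union>
    {frag_of (x, r \<oplus>\<^bsub>R\<^esub> s) - frag_of (x, r) - frag_of (x, s) | x r s.
       x \<in> carrier M \<and> r \<in> carrier R \<and> s \<in> carrier R} \<union>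
    {frag_of (c \<odot>\<^bsub>M\<^esub> x, r) - frag_of (x, c \<odot>\<^bsub>R\<^esub> r) | c x r.
       c \<in> carrier F \<and> x \<in> carrier M \<and> r \<in> carrier R}"

definition tensor_subgroup ::
  "('f, 'm) ring_scheme \<Rightarrow> ('f, 'a, 'n) module_scheme \<Rightarrow> ('f, 'r, 'k) module_scheme \<Rightarrow>
   (('a \<times> 'r) \<Rightarrow>\<^sub>0 int) set"
  where "tensor_subgroup F M R =
    generate (free_Abelian_group (carrier M \<times> carrier R)) (tensor_relations F M R)"

definition tensor_group ::
  "('f, 'm) ring_scheme \<Rightarrow> ('f, 'a, 'n) module_scheme \<Rightarrow> ('f, 'r, 'k) module_scheme \<Rightarrow>
   (('a \<times> 'r) \<Rightarrow>\<^sub>0 int) set monoid"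
  where "tensor_group F M R =
    free_Abelian_group (carrier M \<times> carrier R) Mod tensor_subgroup F M R"

definition pure_tensor ::
  "('f, 'm) ring_scheme \<Rightarrow> ('f, 'a, 'n) module_scheme \<Rightarrow> ('f, 'r, 'k) module_scheme \<Rightarrow>
   'a \<Rightarrow> 'r \<Rightarrow> (('a \<times> 'r) \<Rightarrow>\<^sub>0 int) set"
  where "pure_tensor F M R x r =
    tensor_subgroup F M R #>\<^bsub>free_Abelian_group (carrier M \<times> carrier R)\<^esub> frag_of (x, r)"

definition balanced_map ::
  "('f, 'm) ring_scheme \<Rightarrow> ('f, 'a, 'n) module_scheme \<Rightarrow> ('f, 'r, 'k) module_scheme \<Rightarrow>
   ('g, 'l) monoid_scheme \<Rightarrow> ('a \<Rightarrow> 'r \<Rightarrow> 'g) \<Rightarrow> bool"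
  where "balanced_map F M R G f \<longleftrightarrow>
    (\<forall>x\<in>carrier M. \<forall>r\<in>carrier R. f x r \<in> carrier G) \<and>
    (\<forall>x\<in>carrier M. \<forall>y\<in>carrier M. \<forall>r\<in>carrier R.
       f (x \<oplus>\<^bsub>M\<^esub> y) r = f x r \<otimes>\<^bsub>G\<^esub> f y r) \<and>
    (\<forall>x\<in>carrier M. \<forall>r\<in>carrier R. \<forall>s\<in>carrier R.
       f x (r \<oplus>\<^bsub>R\<^esub> s) = f x r \<otimes>\<^bsub>G\<^esub> f x s) \<and>
    (\<forall>c\<in>carrier F. \<forall>x\<in>carrier M. \<forall>r\<in>carrier R. f (c \<odot>\<^bsub>M\<^esub> x) r = f x (c \<odot>\<^bsub>R\<^esub> r))"

text \<open>
  The homomorphism \<open>M \<otimes>\<^sub>F R \<rightarrow> G\<close> induced by a balanced map \<open>f\<close>; it exists and is unique by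
  the universal property proved below.
\<close>

definition tensor_lift ::
  "('f, 'm) ring_scheme \<Rightarrow> ('f, 'a, 'n) module_scheme \<Rightarrow> ('f, 'r, 'k) module_scheme \<Rightarrow>
   ('g, 'l) monoid_scheme \<Rightarrow> ('a \<Rightarrow> 'r \<Rightarrow> 'g) \<Rightarrow> (('a \<times> 'r) \<Rightarrow>\<^sub>0 int) set \<Rightarrow> 'g"
  where "tensor_lift F M R G f =
    (THE h. h \<in> hom (tensor_group F M R) G \<and> h \<in> extensional (carrier (tensor_group F M R)) \<and>
       (\<forall>x\<in>carrier M. \<forall>r\<in>carrier R. h (pure_tensor F M R x r) = f x r))"

lemma tensor_relations_carrier:
  assumes M: "module F M" and R: "module F R"
  shows "tensor_relations F M R \<subseteq> carrier (free_Abelian_group (carrier M \<times> carrier R))"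
proof -
  interpret M: module F M by (rule M)
  interpret R: module F R by (rule R)
  show ?thesis
    unfolding tensor_relations_def by (auto dest!: subsetD[OF keys_diff])
qed

lemma tensor_subgroup_normal:
  assumes M: "module F M" and R: "module F R"
  shows "tensor_subgroup F M R \<lhd> free_Abelian_group (carrier M \<times> carrier R)"
proof -
  interpret Fr: comm_group "free_Abelian_group (carrier M \<times> carrier R)"
    by (rule abelian_free_Abelian_group)
  show ?thesis
    unfolding tensor_subgroup_def
    by (intro Fr.subgroup_imp_normal Fr.generate_is_subgroup tensor_relations_carrier M R)
qed

lemma tensor_comm_group:
  assumes "module F M" "module F R"
  shows "comm_group (tensor_group F M R)"
  unfolding tensor_group_def
  by (intro comm_group.abelian_FactGroup abelian_free_Abelian_group
      normal_imp_subgroup tensor_subgroup_normal assms)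

lemma pure_tensor_hom:
  assumes M: "module F M" and R: "module F R"
  shows "(\<lambda>c. tensor_subgroup F M R #>\<^bsub>free_Abelian_group (carrier M \<times> carrier R)\<^esub> c)
    \<in> hom (free_Abelian_group (carrier M \<times> carrier R)) (tensor_group F M R)"
  unfolding tensor_group_def by (rule normal.r_coset_hom_Mod[OF tensor_subgroup_normal[OF M R]])

lemma tensor_hom_eqI:
  assumes M: "module F M" and R: "module F R" and G: "group G"
    and h: "h \<in> hom (tensor_group F M R) G" and k: "k \<in> hom (tensor_group F M R) G"
    and eq: "\<And>x r. \<lbrakk>x \<in> carrier M; r \<in> carrier R\<rbrakk> \<Longrightarrow>
      h (pure_tensor F M R x r) = k (pure_tensor F M R x r)"
    and u: "u \<in> carrier (tensor_group F M R)"
  shows "h u = k u"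
proof -
  let ?Fr = "free_Abelian_group (carrier M \<times> carrier R)"
  let ?p = "\<lambda>c. tensor_subgroup F M R #>\<^bsub>?Fr\<^esub> c"
  have hp: "h \<circ> ?p \<in> hom ?Fr G" "k \<circ> ?p \<in> hom ?Fr G"
    using hom_compose[OF pure_tensor_hom[OF M R]] h k by blast+
  interpret hh: group_hom ?Fr G "h \<circ> ?p"
    using hp G by (intro group_hom.intro group_hom_axioms.intro) auto
  interpret kk: group_hom ?Fr G "k \<circ> ?p"
    using hp G by (intro group_hom.intro group_hom_axioms.intro) auto
  have *: "(h \<circ> ?p) c = (k \<circ> ?p) c"
    if "Poly_Mapping.keys c \<subseteq> carrier M \<times> carrier R" for c
    using that
  proof (induction c rule: free_Abelian_group_induct[consumes 1, case_names zero diff gen])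
    case zero
    then show ?case using hh.hom_one kk.hom_one by simp
  next
    case (diff x y)
    then have "x \<in> carrier ?Fr" "inv\<^bsub>?Fr\<^esub> y \<in> carrier ?Fr" "y \<in> carrier ?Fr"
      "x - y = x \<otimes>\<^bsub>?Fr\<^esub> inv\<^bsub>?Fr\<^esub> y" by auto
    then show ?case using diff.IH
      by (simp only: hh.hom_mult kk.hom_mult hh.hom_inv kk.hom_inv)
  next
    case (gen a)
    then show ?case using eq by (cases a) (auto simp: pure_tensor_def)
  qed
  from u obtain c where "c \<in> carrier ?Fr" "u = ?p c"
    by (auto simp: tensor_group_def carrier_FactGroup)
  with *[of c] show ?thesis by simp
qed

lemma tensor_universal_property:
  assumes M: "module F M" and R: "module F R"
    and G: "comm_group G" and f: "balanced_map F M R G f"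
  shows "\<exists>!h. h \<in> hom (tensor_group F M R) G \<and> h \<in> extensional (carrier (tensor_group F M R)) \<and>
       (\<forall>x\<in>carrier M. \<forall>r\<in>carrier R. h (pure_tensor F M R x r) = f x r)"
proof -
  let ?Fr = "free_Abelian_group (carrier M \<times> carrier R)"
  let ?N = "tensor_subgroup F M R"
  let ?T = "tensor_group F M R"
  interpret M: module F M by (rule M)
  interpret R: module F R by (rule R)
  interpret G: comm_group G by (rule G)
  interpret N: normal ?N ?Fr by (rule tensor_subgroup_normal[OF M R])
  have closed: "f x r \<in> carrier G" if "x \<in> carrier M" "r \<in> carrier R" for x r
    using f that by (auto simp: balanced_map_def)
  obtain k where k: "k \<in> hom ?Fr G"
    and kf: "\<And>p. p \<in> carrier M \<times> carrier R \<Longrightarrow> k (frag_of p) = (\<lambda>(x, r). f x r) p"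
    by (rule G.free_Abelian_group_universal[of "\<lambda>(x, r). f x r" "carrier M \<times> carrier R"])
      (use closed in auto)
  interpret k: group_hom ?Fr G k
    using k by (intro group_hom.intro group_hom_axioms.intro) auto
  have cancel: "a \<otimes>\<^bsub>G\<^esub> b \<otimes>\<^bsub>G\<^esub> inv\<^bsub>G\<^esub> a \<otimes>\<^bsub>G\<^esub> inv\<^bsub>G\<^esub> b = \<one>\<^bsub>G\<^esub>"
    if "a \<in> carrier G" "b \<in> carrier G" for a b
    using that G.m_assoc[of "a \<otimes>\<^bsub>G\<^esub> b" "inv\<^bsub>G\<^esub> a" "inv\<^bsub>G\<^esub> b"] G.inv_mult[of a b]
      G.r_inv[of "a \<otimes>\<^bsub>G\<^esub> b"] by simp
  have kdiff: "k (a - b) = k a \<otimes>\<^bsub>G\<^esub> inv\<^bsub>G\<^esub> k b"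
    if "a \<in> carrier ?Fr" "b \<in> carrier ?Fr" for a b
    using that k.hom_mult[of a "inv\<^bsub>?Fr\<^esub> b"] k.hom_inv[of b] by auto
  have frag_diff: "frag_of p - frag_of p' \<in> carrier ?Fr"
    if "p \<in> carrier M \<times> carrier R" "p' \<in> carrier M \<times> carrier R" for p p'
    using that keys_diff[of "frag_of p" "frag_of p'"] by auto
  have "tensor_relations F M R \<subseteq> kernel ?Fr G k"
  proof
    fix c assume c: "c \<in> tensor_relations F M R"
    have cc: "c \<in> carrier ?Fr"
      using c tensor_relations_carrier[OF M R] by blast
    have "k c = \<one>\<^bsub>G\<^esub>"
      using c unfolding tensor_relations_def
    proof (elim UnE CollectE exE conjE)
      fix x y r
      assume *: "c = frag_of (x \<oplus>\<^bsub>M\<^esub> y, r) - frag_of (x, r) - frag_of (y, r)"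
        and m: "x \<in> carrier M" "y \<in> carrier M" "r \<in> carrier R"
      have "k c = f (x \<oplus>\<^bsub>M\<^esub> y) r \<otimes>\<^bsub>G\<^esub> inv\<^bsub>G\<^esub> f x r \<otimes>\<^bsub>G\<^esub> inv\<^bsub>G\<^esub> f y r"
        unfolding * using m by (subst kdiff kdiff; auto simp: kf kdiff simp del: carrier_free_Abelian_group_iff intro: frag_diff)
      also have "f (x \<oplus>\<^bsub>M\<^esub> y) r = f x r \<otimes>\<^bsub>G\<^esub> f y r"
        using f m by (auto simp: balanced_map_def)
      finally show ?thesis using closed m by (simp add: cancel)
    next
      fix x r s
      assume *: "c = frag_of (x, r \<oplus>\<^bsub>R\<^esub> s) - frag_of (x, r) - frag_of (x, s)"
        and m: "x \<in> carrier M" "r \<in> carrier R" "s \<in> carrier R"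
      have "k c = f x (r \<oplus>\<^bsub>R\<^esub> s) \<otimes>\<^bsub>G\<^esub> inv\<^bsub>G\<^esub> f x r \<otimes>\<^bsub>G\<^esub> inv\<^bsub>G\<^esub> f x s"
        unfolding * using m by (subst kdiff kdiff; auto simp: kf kdiff simp del: carrier_free_Abelian_group_iff intro: frag_diff)
      also have "f x (r \<oplus>\<^bsub>R\<^esub> s) = f x r \<otimes>\<^bsub>G\<^esub> f x s"
        using f m by (auto simp: balanced_map_def)
      finally show ?thesis using closed m by (simp add: cancel)
    next
      fix a x r
      assume *: "c = frag_of (a \<odot>\<^bsub>M\<^esub> x, r) - frag_of (x, a \<odot>\<^bsub>R\<^esub> r)"
        and m: "a \<in> carrier F" "x \<in> carrier M" "r \<in> carrier R"
      have "k c = f (a \<odot>\<^bsub>M\<^esub> x) r \<otimes>\<^bsub>G\<^esub> inv\<^bsub>G\<^esub> f x (a \<odot>\<^bsub>R\<^esub> r)"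
        unfolding * using m by (subst kdiff) (auto simp: kf)
      also have "f (a \<odot>\<^bsub>M\<^esub> x) r = f x (a \<odot>\<^bsub>R\<^esub> r)"
        using f m by (auto simp: balanced_map_def)
      finally show ?thesis using closed m by simp
    qed
    with cc show "c \<in> kernel ?Fr G k" by (simp add: kernel_def)
  qed
  then have N_ker: "?N \<subseteq> kernel ?Fr G k"
    unfolding tensor_subgroup_def
    by (rule N.generate_subgroup_incl) (rule k.subgroup_kernel)
  have "k a = k b"
    if a: "a \<in> carrier ?Fr" and b: "b \<in> carrier ?Fr" and ab: "?N #>\<^bsub>?Fr\<^esub> a = ?N #>\<^bsub>?Fr\<^esub> b" for a b
  proof -
    have "a \<in> ?N #>\<^bsub>?Fr\<^esub> b"
      using N.rcos_self[OF a N.subgroup_axioms] ab by simp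
    then obtain n where n: "n \<in> ?N" "a = n \<otimes>\<^bsub>?Fr\<^esub> b" by (auto simp: r_coset_def)
    then show ?thesis
      using N_ker b k.hom_mult[of n b] by (auto simp: kernel_def)
  qed
  then obtain h where h: "h \<in> hom ?T G" "\<And>c. c \<in> carrier ?Fr \<Longrightarrow> h (?N #>\<^bsub>?Fr\<^esub> c) = k c"
    using FactGroup_universal[OF k tensor_subgroup_normal[OF M R]] unfolding tensor_group_def by blast
  have mem: "pure_tensor F M R x r \<in> carrier ?T" if "x \<in> carrier M" "r \<in> carrier R" for x r
    using that by (auto simp: tensor_group_def pure_tensor_def carrier_FactGroup)
  have grT: "group ?T" using tensor_comm_group[OF M R] by (rule comm_group.axioms)
  have hom_restrict: "restrict h (carrier ?T) \<in> hom ?T G"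
    using h(1) grT by (auto simp: hom_def group.subgroup_self monoid.m_closed group.is_monoid)
  have lift: "restrict h (carrier ?T) (pure_tensor F M R x r) = f x r"
    if "x \<in> carrier M" "r \<in> carrier R" for x r
    using that mem h(2)[of "frag_of (x, r)"] kf[of "(x, r)"] by (simp add: pure_tensor_def)
  show ?thesis
  proof (rule ex1I[where a = "restrict h (carrier ?T)"], intro conjI ballI)
    fix x r assume "x \<in> carrier M" "r \<in> carrier R"
    then show "restrict h (carrier ?T) (pure_tensor F M R x r) = f x r" by (rule lift)
  next
    fix h'
    assume h': "h' \<in> hom ?T G \<and> h' \<in> extensional (carrier ?T) \<and>
      (\<forall>x\<in>carrier M. \<forall>r\<in>carrier R. h' (pure_tensor F M R x r) = f x r)"
    have eq: "h' (pure_tensor F M R x r) = restrict h (carrier ?T) (pure_tensor F M R x r)"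
      if "x \<in> carrier M" "r \<in> carrier R" for x r
      using that h' mem[OF that] lift[OF that] by simp
    show "h' = restrict h (carrier ?T)"
    proof (rule extensionalityI[where A = "carrier ?T"])
      fix u assume "u \<in> carrier ?T"
      then show "h' u = restrict h (carrier ?T) u"
        by - (rule tensor_hom_eqI[OF M R G.is_group conjunct1[OF h'] hom_restrict], rule eq)
    next
      show "h' \<in> extensional (carrier ?T)" using h' by blast
    qed simp
  next
    show "restrict h (carrier ?T) \<in> hom ?T G" by (rule hom_restrict)
  qed simp
qed


section \<open>Extension of scalars\<close>

text \<open>
  \<open>M \<otimes>\<^sub>F R\<close> as an \<open>R\<close>-module.  If \<open>M\<close> is an algebra, the \<open>mult\<close> and \<open>one\<close> fields turn it
  into an \<open>R\<close>-algebra; otherwise these two fields carry no meaning.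
\<close>

definition base_change ::
  "('f, 'm) ring_scheme \<Rightarrow> ('f, 'a, 'n) module_scheme \<Rightarrow> ('f, 'r, 'k) module_scheme \<Rightarrow>
   ('r, (('a \<times> 'r) \<Rightarrow>\<^sub>0 int) set) module"
  where "base_change F M R =
    \<lparr>carrier = carrier (tensor_group F M R),
     monoid.mult = (\<lambda>u v. tensor_lift F M R (tensor_group F M R)
               (\<lambda>x r. tensor_lift F M R (tensor_group F M R)
                  (\<lambda>y s. pure_tensor F M R (x \<otimes>\<^bsub>M\<^esub> y) (r \<otimes>\<^bsub>R\<^esub> s)) v) u),
     one = pure_tensor F M R \<one>\<^bsub>M\<^esub> \<one>\<^bsub>R\<^esub>,
     ring.zero = \<one>\<^bsub>tensor_group F M R\<^esub>,
     ring.add = monoid.mult (tensor_group F M R),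
     smult = (\<lambda>r. tensor_lift F M R (tensor_group F M R)
               (\<lambda>x s. pure_tensor F M R x (r \<otimes>\<^bsub>R\<^esub> s)))\<rparr>"

text \<open>The \<open>R\<close>-bilinear extension: \<open>(x \<otimes> r, y \<otimes> s) \<mapsto> b(x, y) r s\<close>.\<close>

definition extend_form ::
  "('f, 'm) ring_scheme \<Rightarrow> ('f, 'a, 'n) module_scheme \<Rightarrow> ('a \<Rightarrow> 'a \<Rightarrow> 'f) \<Rightarrow>
   ('f, 'r, 'k) module_scheme \<Rightarrow>
   (('a \<times> 'r) \<Rightarrow>\<^sub>0 int) set \<Rightarrow> (('a \<times> 'r) \<Rightarrow>\<^sub>0 int) set \<Rightarrow> 'r"
  where "extend_form F M b R u v =
    tensor_lift F M R (add_monoid R)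
      (\<lambda>x r. tensor_lift F M R (add_monoid R) (\<lambda>y s. b x y \<odot>\<^bsub>R\<^esub> (r \<otimes>\<^bsub>R\<^esub> s)) v) u"

definition algebra_hom ::
  "('f, 'm) ring_scheme \<Rightarrow> ('f, 'r, 'k) module_scheme \<Rightarrow> ('f, 's, 'l) module_scheme \<Rightarrow>
   ('r \<Rightarrow> 's) set"
  where "algebra_hom F R S =
    {\<phi> \<in> ring_hom R S. \<forall>c\<in>carrier F. \<forall>r\<in>carrier R. \<phi> (c \<odot>\<^bsub>R\<^esub> r) = c \<odot>\<^bsub>S\<^esub> \<phi> r}"

text \<open>\<open>id \<otimes> \<phi> : M \<otimes>\<^sub>F R \<rightarrow> M \<otimes>\<^sub>F S\<close>\<close>

definition tensor_scalar_map ::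
  "('f, 'm) ring_scheme \<Rightarrow> ('f, 'a, 'n) module_scheme \<Rightarrow> ('f, 'r, 'k) module_scheme \<Rightarrow>
   ('f, 's, 'l) module_scheme \<Rightarrow> ('r \<Rightarrow> 's) \<Rightarrow>
   (('a \<times> 'r) \<Rightarrow>\<^sub>0 int) set \<Rightarrow> (('a \<times> 's) \<Rightarrow>\<^sub>0 int) set"
  where "tensor_scalar_map F M R S \<phi> =
    tensor_lift F M R (tensor_group F M S) (\<lambda>x r. pure_tensor F M S x (\<phi> r))"

text \<open>
  The action of \<open>\<phi> : R \<rightarrow> S\<close> on endomorphisms: an \<open>R\<close>-linear \<open>g\<close> on \<open>M \<otimes>\<^sub>F R\<close> goes to
  \<open>g \<otimes>\<^sub>R S\<close> on \<open>M \<otimes>\<^sub>F S = (M \<otimes>\<^sub>F R) \<otimes>\<^sub>R S\<close>, i.e. to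
  \<open>x \<otimes> s \<mapsto> s ((id \<otimes> \<phi>) (g (x \<otimes> 1)))\<close>.
\<close>

definition transition_map ::
  "('f, 'm) ring_scheme \<Rightarrow> ('f, 'a, 'n) module_scheme \<Rightarrow> ('f, 'r, 'k) module_scheme \<Rightarrow>
   ('f, 's, 'l) module_scheme \<Rightarrow> ('r \<Rightarrow> 's) \<Rightarrow>
   ((('a \<times> 'r) \<Rightarrow>\<^sub>0 int) set \<Rightarrow> (('a \<times> 'r) \<Rightarrow>\<^sub>0 int) set) \<Rightarrow>
   ((('a \<times> 's) \<Rightarrow>\<^sub>0 int) set \<Rightarrow> (('a \<times> 's) \<Rightarrow>\<^sub>0 int) set)"
  where "transition_map F M R S \<phi> g =
    tensor_lift F M S (tensor_group F M S)
      (\<lambda>x s. s \<odot>\<^bsub>base_change F M S\<^esub>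
        tensor_scalar_map F M R S \<phi> (g (pure_tensor F M R x \<one>\<^bsub>R\<^esub>)))"


section \<open>The two group-valued functors\<close>

definition general_linear_group ::
  "('r, 'm) ring_scheme \<Rightarrow> ('r, 'e, 'n) module_scheme \<Rightarrow> ('e \<Rightarrow> 'e) monoid"
  where "general_linear_group R E = BijGroup (carrier E)
    \<lparr>carrier := {g \<in> Bij (carrier E).
       (\<forall>x\<in>carrier E. \<forall>y\<in>carrier E. g (x \<oplus>\<^bsub>E\<^esub> y) = g x \<oplus>\<^bsub>E\<^esub> g y) \<and>
       (\<forall>r\<in>carrier R. \<forall>x\<in>carrier E. g (r \<odot>\<^bsub>E\<^esub> x) = r \<odot>\<^bsub>E\<^esub> g x)}\<rparr>"

text \<open>Preservation of the unity need not be required: it follows from surjectivity.\<close>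

definition algebra_aut_group ::
  "('r, 'm) ring_scheme \<Rightarrow> ('r, 'e, 'n) module_scheme \<Rightarrow> ('e \<Rightarrow> 'e) monoid"
  where "algebra_aut_group R E = general_linear_group R E
    \<lparr>carrier := {g \<in> carrier (general_linear_group R E).
       \<forall>x\<in>carrier E. \<forall>y\<in>carrier E. g (x \<otimes>\<^bsub>E\<^esub> y) = g x \<otimes>\<^bsub>E\<^esub> g y}\<rparr>"

definition isometry_group ::
  "('r, 'm) ring_scheme \<Rightarrow> ('r, 'e, 'n) module_scheme \<Rightarrow> ('e \<Rightarrow> 'e \<Rightarrow> 'r) \<Rightarrow> ('e \<Rightarrow> 'e) monoid"
  where "isometry_group R E b = general_linear_group R E
    \<lparr>carrier := {g \<in> carrier (general_linear_group R E).
       \<forall>x\<in>carrier E. \<forall>y\<in>carrier E. b (g x) (g y) = b x y}\<rparr>"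

text \<open>Both functors act on morphisms by \<^const>\<open>transition_map\<close>.\<close>

definition Aut_scheme ::
  "('f, 'm) ring_scheme \<Rightarrow> ('f, 'a, 'n) module_scheme \<Rightarrow> ('f, 'r, 'k) module_scheme \<Rightarrow>
   ((('a \<times> 'r) \<Rightarrow>\<^sub>0 int) set \<Rightarrow> (('a \<times> 'r) \<Rightarrow>\<^sub>0 int) set) monoid"
  where "Aut_scheme F A R = algebra_aut_group R (base_change F A R)"

definition Isom_scheme ::
  "('f, 'm) ring_scheme \<Rightarrow> ('f, 'a, 'n) module_scheme \<Rightarrow> ('a \<Rightarrow> 'a \<Rightarrow> 'f) \<Rightarrow>
   ('f, 'r, 'k) module_scheme \<Rightarrow>
   ((('a \<times> 'r) \<Rightarrow>\<^sub>0 int) set \<Rightarrow> (('a \<times> 'r) \<Rightarrow>\<^sub>0 int) set) monoid"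
  where "Isom_scheme F M b R = isometry_group R (base_change F M R) (extend_form F M b R)"

text \<open>
  For a subspace \<open>V\<close> of \<open>A\<close>, \<open>V \<otimes>\<^sub>F R\<close> is not literally a subset of \<open>A \<otimes>\<^sub>F R\<close> but embeds in
  it by the canonical injection, along which maps are restricted.
\<close>

definition tensor_inclusion ::
  "('f, 'm) ring_scheme \<Rightarrow> ('f, 'a, 'n) module_scheme \<Rightarrow> ('f, 'a, 'n) module_scheme \<Rightarrow>
   ('f, 'r, 'k) module_scheme \<Rightarrow> (('a \<times> 'r) \<Rightarrow>\<^sub>0 int) set \<Rightarrow> (('a \<times> 'r) \<Rightarrow>\<^sub>0 int) set"
  where "tensor_inclusion F V A R = tensor_lift F V R (tensor_group F A R) (pure_tensor F A R)"

definition tensor_restriction ::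
  "('f, 'm) ring_scheme \<Rightarrow> ('f, 'a, 'n) module_scheme \<Rightarrow> ('f, 'a, 'n) module_scheme \<Rightarrow>
   ('f, 'r, 'k) module_scheme \<Rightarrow>
   ((('a \<times> 'r) \<Rightarrow>\<^sub>0 int) set \<Rightarrow> (('a \<times> 'r) \<Rightarrow>\<^sub>0 int) set) \<Rightarrow>
   ((('a \<times> 'r) \<Rightarrow>\<^sub>0 int) set \<Rightarrow> (('a \<times> 'r) \<Rightarrow>\<^sub>0 int) set)"
  where "tensor_restriction F V A R g =
    (\<lambda>u\<in>carrier (base_change F V R).
       inv_into (carrier (base_change F V R)) (tensor_inclusion F V A R)
         (g (tensor_inclusion F V A R u)))"

end

theory Submission
  imports Defs
begin

text \<open>
  Halving the trace \<open>q(x, 1)\<close> splits the algebra as \<open>A = F 1 \<oplus> V\<close>.  On \<open>V\<close> the conic identity and the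
  commutator condition together say \<open>x y = - B(x, y) 1\<close>, so \<open>A\<close> is the algebra of the bilinear form
  \<open>B\<close>: \<open>(a + v) (b + w) = (a b - B(v, w)) + (a w + b v)\<close> (lemmas \<open>tr_mult\<close>, \<open>pr_mult\<close>).  This
  description survives scalar extension to any commutative algebra \<open>R\<close>: the coordinates of a product
  can be computed on pure tensors (\<open>trR_mult\<close>, \<open>prR_mult\<close>).

  It remains to study the algebra \<open>E\<close> of a bilinear form \<open>\<beta>\<close> on an \<open>R\<close>-module \<open>W\<close>, where 2 is invertible.
  An isometry of \<open>\<beta>\<close> extends to an automorphism of \<open>E\<close> by fixing the unity (\<open>res_surj\<close>), and an automorphism
  is determined by its restriction to \<open>W\<close> (\<open>res_inj\<close>).  The point is that every automorphism \<open>g\<close>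
  preserves \<open>W\<close> (\<open>aut_trace\<close>).  Over a field this is immediate, for \<open>W\<close> consists of zero and the
  nonscalar elements with scalar square.  Over a ring with zero divisors one only gets that the
  scalar part \<open>s(v)\<close> of \<open>g v\<close> satisfies \<open>s(v) v = 0\<close>.  But \<open>s\<close> is linear in \<open>v\<close>, and in \<open>V \<otimes> R\<close> the
  vectors \<open>e \<otimes> 1\<close> with \<open>e\<close> nonzero have no annihilator, since some functional on \<open>V\<close> takes the value 1 at
  \<open>e\<close> (\<open>exists_functional\<close>).  Thus \<open>s = 0\<close>.  Restriction then preserves the form because products of
  elements of \<open>W\<close> are the scalars \<open>- \<beta>(v, w) 1\<close>.

  Naturality in \<open>R\<close> follows from the injectivity of \<open>V \<otimes> S \<rightarrow> A \<otimes> S\<close> and a comparison on pure tensors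
  (\<open>restriction_natural\<close>).
\<close>

section \<open>Linear maps and the groups they form\<close>

definition linear_map ::
  "('r, 'm) ring_scheme \<Rightarrow> ('r, 'a, 'n) module_scheme \<Rightarrow> ('r, 'b, 'k) module_scheme \<Rightarrow> ('a \<Rightarrow> 'b) \<Rightarrow> bool"
  where "linear_map R M N f \<longleftrightarrow>
    (\<forall>x\<in>carrier M. f x \<in> carrier N) \<and>
    (\<forall>x\<in>carrier M. \<forall>y\<in>carrier M. f (x \<oplus>\<^bsub>M\<^esub> y) = f x \<oplus>\<^bsub>N\<^esub> f y) \<and>
    (\<forall>r\<in>carrier R. \<forall>x\<in>carrier M. f (r \<odot>\<^bsub>M\<^esub> x) = r \<odot>\<^bsub>N\<^esub> f x)"

definition linear_functional ::
  "('r, 'm) ring_scheme \<Rightarrow> ('r, 'a, 'n) module_scheme \<Rightarrow> ('a \<Rightarrow> 'r) \<Rightarrow> bool"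
  where "linear_functional R M f \<longleftrightarrow>
    (\<forall>x\<in>carrier M. f x \<in> carrier R) \<and>
    (\<forall>x\<in>carrier M. \<forall>y\<in>carrier M. f (x \<oplus>\<^bsub>M\<^esub> y) = f x \<oplus>\<^bsub>R\<^esub> f y) \<and>
    (\<forall>r\<in>carrier R. \<forall>x\<in>carrier M. f (r \<odot>\<^bsub>M\<^esub> x) = r \<otimes>\<^bsub>R\<^esub> f x)"

lemma linear_mapD:
  assumes "linear_map R M N f"
  shows "x \<in> carrier M \<Longrightarrow> f x \<in> carrier N"
    and "\<lbrakk>x \<in> carrier M; y \<in> carrier M\<rbrakk> \<Longrightarrow> f (x \<oplus>\<^bsub>M\<^esub> y) = f x \<oplus>\<^bsub>N\<^esub> f y"
    and "\<lbrakk>r \<in> carrier R; x \<in> carrier M\<rbrakk> \<Longrightarrow> f (r \<odot>\<^bsub>M\<^esub> x) = r \<odot>\<^bsub>N\<^esub> f x"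
  using assms by (simp_all add: linear_map_def)

lemma linear_functionalD:
  assumes "linear_functional R M f"
  shows "x \<in> carrier M \<Longrightarrow> f x \<in> carrier R"
    and "\<lbrakk>x \<in> carrier M; y \<in> carrier M\<rbrakk> \<Longrightarrow> f (x \<oplus>\<^bsub>M\<^esub> y) = f x \<oplus>\<^bsub>R\<^esub> f y"
    and "\<lbrakk>r \<in> carrier R; x \<in> carrier M\<rbrakk> \<Longrightarrow> f (r \<odot>\<^bsub>M\<^esub> x) = r \<otimes>\<^bsub>R\<^esub> f x"
  using assms by (simp_all add: linear_functional_def)

lemma linear_functional_zero:
  assumes f: "linear_functional R M f" and M: "module R M"
  shows "f \<zero>\<^bsub>M\<^esub> = \<zero>\<^bsub>R\<^esub>"
proof -
  interpret M: module R M by (rule M)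
  have "f (\<zero>\<^bsub>R\<^esub> \<odot>\<^bsub>M\<^esub> \<zero>\<^bsub>M\<^esub>) = \<zero>\<^bsub>R\<^esub> \<otimes>\<^bsub>R\<^esub> f \<zero>\<^bsub>M\<^esub>"
    by (intro linear_functionalD(3)[OF f]) auto
  then show ?thesis using linear_functionalD(1)[OF f, of "\<zero>\<^bsub>M\<^esub>"] by simp
qed

lemma carrier_general_linear_group:
  "g \<in> carrier (general_linear_group R E) \<longleftrightarrow> g \<in> Bij (carrier E) \<and> linear_map R E E g"
  using Bij_imp_funcset[of g "carrier E"]
  by (auto simp: general_linear_group_def linear_map_def)

lemma carrier_algebra_aut_group:
  "g \<in> carrier (algebra_aut_group R E) \<longleftrightarrow> g \<in> Bij (carrier E) \<and> linear_map R E E g \<and>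
     (\<forall>x\<in>carrier E. \<forall>y\<in>carrier E. g (x \<otimes>\<^bsub>E\<^esub> y) = g x \<otimes>\<^bsub>E\<^esub> g y)"
  by (auto simp: algebra_aut_group_def carrier_general_linear_group)

lemma carrier_isometry_group:
  "g \<in> carrier (isometry_group R E b) \<longleftrightarrow> g \<in> Bij (carrier E) \<and> linear_map R E E g \<and>
     (\<forall>x\<in>carrier E. \<forall>y\<in>carrier E. b (g x) (g y) = b x y)"
  by (auto simp: isometry_group_def carrier_general_linear_group)

text \<open>
  Automorphism groups and isometry groups are both cut out of \<open>BijGroup\<close> by replacing its carrier, so one
  closure criterion serves for both.
\<close>

lemma group_of_bijections:
  assumes sub: "H \<subseteq> Bij S" and id: "(\<lambda>x\<in>S. x) \<in> H"
    and comp: "\<And>f g. \<lbrakk>f \<in> H; g \<in> H\<rbrakk> \<Longrightarrow> compose S f g \<in> H"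
    and inv: "\<And>f. f \<in> H \<Longrightarrow> restrict (inv_into S f) S \<in> H"
  shows "group (BijGroup S\<lparr>carrier := H\<rparr>)"
proof -
  interpret group "BijGroup S" by (rule group_BijGroup)
  have "subgroup H (BijGroup S)"
  proof (rule subgroupI)
    show "H \<subseteq> carrier (BijGroup S)" using sub by (simp add: BijGroup_def)
    show "H \<noteq> {}" using id by blast
    show "inv\<^bsub>BijGroup S\<^esub> f \<in> H" if "f \<in> H" for f
      using that sub inv by (subst inv_BijGroup) auto
    show "f \<otimes>\<^bsub>BijGroup S\<^esub> g \<in> H" if "f \<in> H" "g \<in> H" for f g
    proof -
      from that sub have "f \<in> Bij S" "g \<in> Bij S" by auto
      then show ?thesis using that comp by (simp add: BijGroup_def)
    qed
  qed
  then show ?thesis by (rule subgroup.subgroup_is_group) (rule group_BijGroup)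
qed

lemma Bij_inv:
  assumes "f \<in> Bij S" "x \<in> S"
  shows "inv_into S f x \<in> S" "f (inv_into S f x) = x" "inv_into S f (f x) = x"
  using assms by (auto simp: Bij_def bij_betw_def f_inv_into_f inv_into_into)

lemma linear_map_id: "module R E \<Longrightarrow> linear_map R E E (\<lambda>x\<in>carrier E. x)"
  by (simp add: linear_map_def module.smult_closed abelian_groupE(1) module.axioms(2))

lemma linear_map_compose:
  assumes E: "module R E" and f: "linear_map R E E f" and g: "linear_map R E E g"
  shows "linear_map R E E (compose (carrier E) f g)"
proof -
  interpret module R E by (rule E)
  show ?thesis using f g by (simp add: linear_map_def compose_def)
qed

lemma linear_map_inverse:
  assumes E: "module R E" and f: "linear_map R E E f" and b: "f \<in> Bij (carrier E)"
  shows "linear_map R E E (restrict (inv_into (carrier E) f) (carrier E))"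
proof -
  interpret module R E by (rule E)
  let ?k = "inv_into (carrier E) f"
  have "?k (x \<oplus>\<^bsub>E\<^esub> y) = ?k x \<oplus>\<^bsub>E\<^esub> ?k y" if "x \<in> carrier E" "y \<in> carrier E" for x y
    using Bij_inv(3)[OF b, of "?k x \<oplus>\<^bsub>E\<^esub> ?k y"] Bij_inv(1,2)[OF b] that
    by (simp add: linear_mapD[OF f])
  moreover have "?k (r \<odot>\<^bsub>E\<^esub> x) = r \<odot>\<^bsub>E\<^esub> ?k x" if "r \<in> carrier R" "x \<in> carrier E" for r x
    using Bij_inv(3)[OF b, of "r \<odot>\<^bsub>E\<^esub> ?k x"] Bij_inv(1,2)[OF b] that
    by (simp add: linear_mapD[OF f])
  ultimately show ?thesis
    by (simp add: linear_map_def Bij_inv(1)[OF b])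
qed

lemma group_algebra_aut_group:
  assumes E: "module R E"
    and closed: "\<And>x y. \<lbrakk>x \<in> carrier E; y \<in> carrier E\<rbrakk> \<Longrightarrow> x \<otimes>\<^bsub>E\<^esub> y \<in> carrier E"
  shows "group (algebra_aut_group R E)"
proof -
  have "group (BijGroup (carrier E)\<lparr>carrier := carrier (algebra_aut_group R E)\<rparr>)"
  proof (rule group_of_bijections)
    show "carrier (algebra_aut_group R E) \<subseteq> Bij (carrier E)"
      by (auto simp: carrier_algebra_aut_group)
    show "(\<lambda>x\<in>carrier E. x) \<in> carrier (algebra_aut_group R E)"
      by (simp add: carrier_algebra_aut_group id_Bij linear_map_id[OF E] closed)
  next
    fix f g
    assume "f \<in> carrier (algebra_aut_group R E)" "g \<in> carrier (algebra_aut_group R E)"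
    then show "compose (carrier E) f g \<in> carrier (algebra_aut_group R E)"
      by (simp add: carrier_algebra_aut_group compose_Bij linear_map_compose[OF E])
        (simp add: compose_def closed linear_map_def)
  next
    fix f
    assume f: "f \<in> carrier (algebra_aut_group R E)"
    then have b: "f \<in> Bij (carrier E)" and l: "linear_map R E E f"
      and m: "\<And>x y. \<lbrakk>x \<in> carrier E; y \<in> carrier E\<rbrakk> \<Longrightarrow> f (x \<otimes>\<^bsub>E\<^esub> y) = f x \<otimes>\<^bsub>E\<^esub> f y"
      by (auto simp: carrier_algebra_aut_group)
    let ?k = "inv_into (carrier E) f"
    have "?k (x \<otimes>\<^bsub>E\<^esub> y) = ?k x \<otimes>\<^bsub>E\<^esub> ?k y" if "x \<in> carrier E" "y \<in> carrier E" for x y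
      using Bij_inv(3)[OF b, of "?k x \<otimes>\<^bsub>E\<^esub> ?k y"] Bij_inv(1,2)[OF b] that
      by (simp add: m closed)
    then show "restrict ?k (carrier E) \<in> carrier (algebra_aut_group R E)"
      by (simp add: carrier_algebra_aut_group restrict_inv_into_Bij[OF b] linear_map_inverse[OF E l b] closed)
  qed
  then show ?thesis by (simp add: algebra_aut_group_def general_linear_group_def)
qed

lemma group_isometry_group:
  assumes E: "module R E"
  shows "group (isometry_group R E b)"
proof -
  interpret module R E by (rule E)
  have "group (BijGroup (carrier E)\<lparr>carrier := carrier (isometry_group R E b)\<rparr>)"
  proof (rule group_of_bijections)
    show "carrier (isometry_group R E b) \<subseteq> Bij (carrier E)"
      by (auto simp: carrier_isometry_group)
    show "(\<lambda>x\<in>carrier E. x) \<in> carrier (isometry_group R E b)"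
      by (simp add: carrier_isometry_group id_Bij linear_map_id[OF E])
  next
    fix f g
    assume "f \<in> carrier (isometry_group R E b)" "g \<in> carrier (isometry_group R E b)"
    then show "compose (carrier E) f g \<in> carrier (isometry_group R E b)"
      by (simp add: carrier_isometry_group compose_Bij linear_map_compose[OF E])
        (simp add: compose_def linear_map_def)
  next
    fix f
    assume f: "f \<in> carrier (isometry_group R E b)"
    then have bi: "f \<in> Bij (carrier E)" and l: "linear_map R E E f"
      and m: "\<And>x y. \<lbrakk>x \<in> carrier E; y \<in> carrier E\<rbrakk> \<Longrightarrow> b (f x) (f y) = b x y"
      by (auto simp: carrier_isometry_group)
    let ?k = "inv_into (carrier E) f"
    have "b (?k x) (?k y) = b x y" if "x \<in> carrier E" "y \<in> carrier E" for x y
      using m[of "?k x" "?k y"] Bij_inv[OF bi] that by simp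
    then show "restrict ?k (carrier E) \<in> carrier (isometry_group R E b)"
      by (simp add: carrier_isometry_group restrict_inv_into_Bij[OF bi] linear_map_inverse[OF E l bi])
  qed
  then show ?thesis by (simp add: isometry_group_def general_linear_group_def)
qed

lemma mult_algebra_aut_group:
  assumes "f \<in> carrier (algebra_aut_group R E)" "g \<in> carrier (algebra_aut_group R E)"
  shows "f \<otimes>\<^bsub>algebra_aut_group R E\<^esub> g = compose (carrier E) f g"
  using assms unfolding carrier_algebra_aut_group
  by (simp add: algebra_aut_group_def general_linear_group_def BijGroup_def)

lemma mult_isometry_group:
  assumes "f \<in> carrier (isometry_group R E b)" "g \<in> carrier (isometry_group R E b)"
  shows "f \<otimes>\<^bsub>isometry_group R E b\<^esub> g = compose (carrier E) f g"
  using assms unfolding carrier_isometry_group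
  by (simp add: isometry_group_def general_linear_group_def BijGroup_def)


section \<open>Automorphisms of the algebra of a bilinear form\<close>

text \<open>
  The algebra of a bilinear form \<open>\<beta>\<close> is \<open>R \<oplus> W\<close> with
  \<open>(a, v) (b, w) = (a b - \<beta>(v, w), a w + b v)\<close>.  It is described here by its coordinates \<open>t : E \<rightarrow> R\<close> and
  \<open>p : E \<rightarrow> W\<close> and the inclusion \<open>j : W \<rightarrow> E\<close>, because a scalar extension of a Vidinli algebra has
  such a decomposition only up to isomorphism.  Distributivity and the unit laws follow from the
  product formula in coordinates.

  The hypothesis on functionals \<open>s\<close> with \<open>s(v) v = 0\<close> is a weak form of torsion-freeness.  Over a ring \<open>R\<close> with
  zero divisors it replaces cancellation of a nonzero vector; it holds whenever \<open>W\<close> is free.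
\<close>

locale bilinear_form_algebra =
  E: module R E + W: module R W
  for R (structure) and E (structure) and W (structure) +
  fixes t p j and \<beta>
  assumes t: "linear_functional R E t"
    and p: "linear_map R E W p"
    and j: "linear_map R W E j"
    and one_closed: "\<one>\<^bsub>E\<^esub> \<in> carrier E"
    and t_one: "t \<one>\<^bsub>E\<^esub> = \<one>\<^bsub>R\<^esub>"
    and p_one: "p \<one>\<^bsub>E\<^esub> = \<zero>\<^bsub>W\<^esub>"
    and t_j: "v \<in> carrier W \<Longrightarrow> t (j v) = \<zero>\<^bsub>R\<^esub>"
    and p_j: "v \<in> carrier W \<Longrightarrow> p (j v) = v"
    and decomposition: "u \<in> carrier E \<Longrightarrow> u = t u \<odot>\<^bsub>E\<^esub> \<one>\<^bsub>E\<^esub> \<oplus>\<^bsub>E\<^esub> j (p u)"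
    and form: "bilinear_form R W \<beta>"
    and mult_closed: "\<lbrakk>u \<in> carrier E; v \<in> carrier E\<rbrakk> \<Longrightarrow> u \<otimes>\<^bsub>E\<^esub> v \<in> carrier E"
    and t_mult: "\<lbrakk>u \<in> carrier E; v \<in> carrier E\<rbrakk> \<Longrightarrow>
      t (u \<otimes>\<^bsub>E\<^esub> v) = t u \<otimes>\<^bsub>R\<^esub> t v \<ominus>\<^bsub>R\<^esub> \<beta> (p u) (p v)"
    and p_mult: "\<lbrakk>u \<in> carrier E; v \<in> carrier E\<rbrakk> \<Longrightarrow>
      p (u \<otimes>\<^bsub>E\<^esub> v) = t u \<odot>\<^bsub>W\<^esub> p v \<oplus>\<^bsub>W\<^esub> t v \<odot>\<^bsub>W\<^esub> p u"
    and two_unit: "\<exists>h\<in>carrier R. h \<otimes>\<^bsub>R\<^esub> (\<one>\<^bsub>R\<^esub> \<oplus>\<^bsub>R\<^esub> \<one>\<^bsub>R\<^esub>) = \<one>\<^bsub>R\<^esub>"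
    and functional_vanishes: "\<lbrakk>linear_functional R W s;
      \<And>v. v \<in> carrier W \<Longrightarrow> s v \<odot>\<^bsub>W\<^esub> v = \<zero>\<^bsub>W\<^esub>; v \<in> carrier W\<rbrakk> \<Longrightarrow> s v = \<zero>\<^bsub>R\<^esub>"
begin

lemmas tD = linear_functionalD[OF t]
lemmas pD = linear_mapD[OF p]
lemmas jD = linear_mapD[OF j]

lemma form_closed: "\<lbrakk>v \<in> carrier W; w \<in> carrier W\<rbrakk> \<Longrightarrow> \<beta> v w \<in> carrier R"
  using form by (simp add: bilinear_form_def)

lemma form_zero:
  assumes v: "v \<in> carrier W"
  shows "\<beta> \<zero>\<^bsub>W\<^esub> v = \<zero>\<^bsub>R\<^esub>" "\<beta> v \<zero>\<^bsub>W\<^esub> = \<zero>\<^bsub>R\<^esub>"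
proof -
  have "\<beta> (\<zero>\<^bsub>R\<^esub> \<odot>\<^bsub>W\<^esub> v) v = \<zero>\<^bsub>R\<^esub> \<otimes>\<^bsub>R\<^esub> \<beta> v v" "\<beta> v (\<zero>\<^bsub>R\<^esub> \<odot>\<^bsub>W\<^esub> v) = \<zero>\<^bsub>R\<^esub> \<otimes>\<^bsub>R\<^esub> \<beta> v v"
    using form v unfolding bilinear_form_def by (metis E.R.zero_closed)+
  then show "\<beta> \<zero>\<^bsub>W\<^esub> v = \<zero>\<^bsub>R\<^esub>" "\<beta> v \<zero>\<^bsub>W\<^esub> = \<zero>\<^bsub>R\<^esub>"
    using v form_closed[OF v v] by simp_all
qed

lemma coordinates_eqI:
  assumes "u \<in> carrier E" "v \<in> carrier E" "t u = t v" "p u = p v"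
  shows "u = v"
  by (rule trans[OF decomposition[OF assms(1)]], rule trans[OF _ decomposition[OF assms(2), symmetric]])
    (simp only: assms(3,4))

lemma t_sum: "\<lbrakk>r \<in> carrier R; v \<in> carrier W\<rbrakk> \<Longrightarrow> t (r \<odot>\<^bsub>E\<^esub> \<one>\<^bsub>E\<^esub> \<oplus>\<^bsub>E\<^esub> j v) = r"
  by (simp add: tD jD one_closed t_one t_j)

lemma p_sum: "\<lbrakk>r \<in> carrier R; v \<in> carrier W\<rbrakk> \<Longrightarrow> p (r \<odot>\<^bsub>E\<^esub> \<one>\<^bsub>E\<^esub> \<oplus>\<^bsub>E\<^esub> j v) = v"
  by (simp add: pD jD one_closed p_one p_j)

lemma inj_j: "inj_on j (carrier W)"
  by (rule inj_on_inverseI[of _ p]) (rule p_j)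

lemma unit_laws:
  assumes u: "u \<in> carrier E"
  shows "\<one>\<^bsub>E\<^esub> \<otimes>\<^bsub>E\<^esub> u = u" "u \<otimes>\<^bsub>E\<^esub> \<one>\<^bsub>E\<^esub> = u"
  by (rule coordinates_eqI;
      simp add: u mult_closed one_closed t_mult p_mult t_one p_one form_zero tD pD a_minus_def)+

lemma mult_j:
  assumes v: "v \<in> carrier W" and w: "w \<in> carrier W"
  shows "j v \<otimes>\<^bsub>E\<^esub> j w = (\<ominus>\<^bsub>R\<^esub> \<beta> v w) \<odot>\<^bsub>E\<^esub> \<one>\<^bsub>E\<^esub>"
  by (rule coordinates_eqI)
    (simp_all add: v w mult_closed one_closed t_mult p_mult t_one p_one form_closed tD pD jD t_j p_j a_minus_def)

context
  fixes g assumes g: "g \<in> carrier (algebra_aut_group R E)"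
begin

lemma aut_bij: "g \<in> Bij (carrier E)"
  and aut_linear: "linear_map R E E g"
  and aut_mult: "\<lbrakk>x \<in> carrier E; y \<in> carrier E\<rbrakk> \<Longrightarrow> g (x \<otimes>\<^bsub>E\<^esub> y) = g x \<otimes>\<^bsub>E\<^esub> g y"
  using g by (auto simp: carrier_algebra_aut_group)

lemmas gD = linear_mapD[OF aut_linear]

lemma aut_one: "g \<one>\<^bsub>E\<^esub> = \<one>\<^bsub>E\<^esub>"
proof -
  obtain z where z: "z \<in> carrier E" "g z = \<one>\<^bsub>E\<^esub>"
    using Bij_inv[OF aut_bij one_closed] by blast
  have "g \<one>\<^bsub>E\<^esub> = g \<one>\<^bsub>E\<^esub> \<otimes>\<^bsub>E\<^esub> g z" using unit_laws gD(1) one_closed z by simp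
  also have "\<dots> = g (\<one>\<^bsub>E\<^esub> \<otimes>\<^bsub>E\<^esub> z)" using aut_mult one_closed z by simp
  finally show ?thesis using unit_laws z by simp
qed

lemma aut_inj: "\<lbrakk>x \<in> carrier E; y \<in> carrier E; g x = g y\<rbrakk> \<Longrightarrow> x = y"
  using aut_bij by (auto simp: Bij_def bij_betw_def inj_on_def)

text \<open>
  This is why automorphisms restrict to \<open>W\<close>.  Write \<open>g (j v) = s 1 + j w\<close>.  Since \<open>(j v)\<^sup>2\<close> is a scalar, so
  is \<open>(g (j v))\<^sup>2\<close>, whose component in \<open>W\<close> is \<open>2 s w\<close>; as 2 is invertible, \<open>s w = 0\<close>.  Hence
  \<open>g (s (j v)) = s\<^sup>2 1 = g (s\<^sup>2 1)\<close>, and injectivity of \<open>g\<close> gives \<open>s (j v) = s\<^sup>2 1\<close>, so that \<open>s v = 0\<close>.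
  Here \<open>s\<close> depends linearly on \<open>v\<close>, so it vanishes by the hypothesis on such functionals.
\<close>

lemma aut_trace:
  assumes v: "v \<in> carrier W"
  shows "t (g (j v)) = \<zero>\<^bsub>R\<^esub>"
proof (rule functional_vanishes[OF _ _ v])
  show "linear_functional R W (\<lambda>v. t (g (j v)))"
    by (simp add: linear_functional_def tD gD jD)
next
  fix v assume v: "v \<in> carrier W"
  define s where "s = t (g (j v))"
  define w where "w = p (g (j v))"
  have c: "s \<in> carrier R" "w \<in> carrier W" "j v \<in> carrier E" "g (j v) \<in> carrier E"
    using v by (simp_all add: s_def w_def tD pD gD jD)
  have "p (g (j v) \<otimes>\<^bsub>E\<^esub> g (j v)) = p (g (j v \<otimes>\<^bsub>E\<^esub> j v))"
    using c by (simp add: aut_mult)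
  also have "\<dots> = \<zero>\<^bsub>W\<^esub>"
    using v by (simp add: mult_j gD one_closed form_closed aut_one pD p_one)
  finally have "s \<odot>\<^bsub>W\<^esub> w \<oplus>\<^bsub>W\<^esub> s \<odot>\<^bsub>W\<^esub> w = \<zero>\<^bsub>W\<^esub>"
    using c by (simp add: p_mult s_def w_def)
  then have twice: "(\<one>\<^bsub>R\<^esub> \<oplus>\<^bsub>R\<^esub> \<one>\<^bsub>R\<^esub>) \<odot>\<^bsub>W\<^esub> (s \<odot>\<^bsub>W\<^esub> w) = \<zero>\<^bsub>W\<^esub>"
    using c by (simp add: W.smult_l_distr)
  obtain h where h: "h \<in> carrier R" "h \<otimes>\<^bsub>R\<^esub> (\<one>\<^bsub>R\<^esub> \<oplus>\<^bsub>R\<^esub> \<one>\<^bsub>R\<^esub>) = \<one>\<^bsub>R\<^esub>"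
    using two_unit by blast
  have "s \<odot>\<^bsub>W\<^esub> w = (h \<otimes>\<^bsub>R\<^esub> (\<one>\<^bsub>R\<^esub> \<oplus>\<^bsub>R\<^esub> \<one>\<^bsub>R\<^esub>)) \<odot>\<^bsub>W\<^esub> (s \<odot>\<^bsub>W\<^esub> w)"
    using h c by simp
  also have "\<dots> = \<zero>\<^bsub>W\<^esub>"
    using h(1) c twice W.smult_assoc1[of h "\<one>\<^bsub>R\<^esub> \<oplus>\<^bsub>R\<^esub> \<one>\<^bsub>R\<^esub>" "s \<odot>\<^bsub>W\<^esub> w"] by simp
  finally have sw: "s \<odot>\<^bsub>W\<^esub> w = \<zero>\<^bsub>W\<^esub>" .
  have "g (s \<odot>\<^bsub>E\<^esub> j v) = g ((s \<otimes>\<^bsub>R\<^esub> s) \<odot>\<^bsub>E\<^esub> \<one>\<^bsub>E\<^esub>)"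
  proof (rule coordinates_eqI)
    show "t (g (s \<odot>\<^bsub>E\<^esub> j v)) = t (g ((s \<otimes>\<^bsub>R\<^esub> s) \<odot>\<^bsub>E\<^esub> \<one>\<^bsub>E\<^esub>))"
      using c by (simp add: gD tD one_closed aut_one t_one flip: s_def)
    show "p (g (s \<odot>\<^bsub>E\<^esub> j v)) = p (g ((s \<otimes>\<^bsub>R\<^esub> s) \<odot>\<^bsub>E\<^esub> \<one>\<^bsub>E\<^esub>))"
      using c sw by (simp add: gD pD one_closed aut_one p_one flip: w_def)
  qed (use c in \<open>simp_all add: gD one_closed\<close>)
  then have "s \<odot>\<^bsub>E\<^esub> j v = (s \<otimes>\<^bsub>R\<^esub> s) \<odot>\<^bsub>E\<^esub> \<one>\<^bsub>E\<^esub>"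
    by (rule aut_inj[rotated 2]) (simp_all add: c one_closed)
  then have "p (s \<odot>\<^bsub>E\<^esub> j v) = p ((s \<otimes>\<^bsub>R\<^esub> s) \<odot>\<^bsub>E\<^esub> \<one>\<^bsub>E\<^esub>)" by simp
  then show "t (g (j v)) \<odot>\<^bsub>W\<^esub> v = \<zero>\<^bsub>W\<^esub>"
    using c v by (simp add: pD p_j p_one one_closed flip: s_def)
qed

lemma aut_j:
  assumes v: "v \<in> carrier W"
  shows "g (j v) = j (p (g (j v)))"
  by (rule coordinates_eqI) (simp_all add: v aut_trace[OF v] gD jD pD t_j p_j)

end

definition res where "res g = (\<lambda>v\<in>carrier W. inv_into (carrier W) j (g (j v)))"

lemma res_eq:
  assumes "g \<in> carrier (algebra_aut_group R E)" "v \<in> carrier W"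
  shows "res g v = p (g (j v))"
proof -
  have "p (g (j v)) \<in> carrier W" using assms by (simp add: pD jD gD)
  then have "inv_into (carrier W) j (j (p (g (j v)))) = p (g (j v))"
    by (rule inv_into_f_f[OF inj_j])
  then show ?thesis using aut_j[OF assms] assms(2) by (simp add: res_def)
qed

lemma j_res:
  assumes "g \<in> carrier (algebra_aut_group R E)" "v \<in> carrier W"
  shows "j (res g v) = g (j v)"
  using aut_j[OF assms] res_eq[OF assms] by simp

lemma res_isometry:
  assumes g: "g \<in> carrier (algebra_aut_group R E)"
  shows "res g \<in> carrier (isometry_group R W \<beta>)"
proof -
  note gD = gD[OF g]
  have closed: "res g v \<in> carrier W" if "v \<in> carrier W" for v
    using that by (simp add: res_eq[OF g] pD gD jD)
  have lin: "linear_map R W W (res g)"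
    by (simp add: linear_map_def res_eq[OF g] pD gD jD)
  have iso: "\<beta> (res g v) (res g w) = \<beta> v w" if v: "v \<in> carrier W" and w: "w \<in> carrier W" for v w
  proof -
    have "(\<ominus>\<^bsub>R\<^esub> \<beta> (res g v) (res g w)) \<odot>\<^bsub>E\<^esub> \<one>\<^bsub>E\<^esub> = g (j v) \<otimes>\<^bsub>E\<^esub> g (j w)"
      using v w closed by (simp flip: mult_j add: j_res[OF g])
    also have "\<dots> = g (j v \<otimes>\<^bsub>E\<^esub> j w)" using v w by (simp add: aut_mult[OF g] jD)
    also have "\<dots> = (\<ominus>\<^bsub>R\<^esub> \<beta> v w) \<odot>\<^bsub>E\<^esub> \<one>\<^bsub>E\<^esub>"
      using v w by (simp add: mult_j gD one_closed form_closed aut_one[OF g])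
    finally have "t ((\<ominus>\<^bsub>R\<^esub> \<beta> (res g v) (res g w)) \<odot>\<^bsub>E\<^esub> \<one>\<^bsub>E\<^esub>) = t ((\<ominus>\<^bsub>R\<^esub> \<beta> v w) \<odot>\<^bsub>E\<^esub> \<one>\<^bsub>E\<^esub>)"
      by simp
    then have "\<ominus>\<^bsub>R\<^esub> \<beta> (res g v) (res g w) = \<ominus>\<^bsub>R\<^esub> \<beta> v w"
      using v w closed by (simp add: tD one_closed form_closed t_one)
    then show ?thesis
      using v w closed form_closed by (metis E.R.minus_minus)
  qed
  have bij: "bij_betw (res g) (carrier W) (carrier W)"
  proof (rule bij_betw_imageI)
    show "inj_on (res g) (carrier W)"
    proof (rule inj_onI)
      fix v w assume v: "v \<in> carrier W" and w: "w \<in> carrier W" and "res g v = res g w"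
      then have "g (j v) = g (j w)" using j_res[OF g] by metis
      then have "j v = j w" using aut_inj[OF g] jD v w by blast
      then show "v = w" using inj_j v w by (auto dest: inj_onD)
    qed
    show "res g ` carrier W = carrier W"
    proof
      show "res g ` carrier W \<subseteq> carrier W" using closed by blast
      show "carrier W \<subseteq> res g ` carrier W"
      proof
        fix w assume w: "w \<in> carrier W"
        \<comment> \<open>The preimage \<open>u\<close> of \<open>j w\<close> need not be known to lie in \<open>j W\<close>; comparing the \<open>W\<close>-components of \<open>g u\<close> is enough.\<close>
        define u where "u = inv_into (carrier E) g (j w)"
        have u: "u \<in> carrier E" "g u = j w"
          using Bij_inv[OF aut_bij[OF g], of "j w"] w jD by (auto simp: u_def)
        have c: "t u \<in> carrier R" "p u \<in> carrier W" using u by (simp_all add: tD pD)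
        have "g u = g (t u \<odot>\<^bsub>E\<^esub> \<one>\<^bsub>E\<^esub> \<oplus>\<^bsub>E\<^esub> j (p u))"
          by (rule arg_cong[OF decomposition[OF u(1)]])
        also have "\<dots> = t u \<odot>\<^bsub>E\<^esub> \<one>\<^bsub>E\<^esub> \<oplus>\<^bsub>E\<^esub> j (res g (p u))"
          using c by (simp add: gD jD one_closed aut_one[OF g] j_res[OF g])
        finally have "p (j w) = res g (p u)"
          using c u closed by (simp add: p_sum)
        then have "w = res g (p u)" using w by (simp add: p_j)
        then show "w \<in> res g ` carrier W" using c by blast
      qed
    qed
  qed
  have "res g \<in> extensional (carrier W)" by (simp add: res_def)
  with bij lin iso show ?thesis by (simp add: carrier_isometry_group Bij_def)
qed

lemma res_compose:
  assumes g: "g \<in> carrier (algebra_aut_group R E)" and g': "g' \<in> carrier (algebra_aut_group R E)"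
  shows "res (compose (carrier E) g g') = compose (carrier W) (res g) (res g')"
proof (rule extensionalityI[of _ "carrier W"])
  fix v assume v: "v \<in> carrier W"
  have "res g' v \<in> carrier W"
    using res_isometry[OF g'] v by (simp add: carrier_isometry_group linear_map_def)
  then have "compose (carrier W) (res g) (res g') v = inv_into (carrier W) j (g (j (res g' v)))"
    using v by (simp add: compose_eq res_def[of g])
  also have "\<dots> = res (compose (carrier E) g g') v"
    unfolding res_def[of "compose (carrier E) g g'"] j_res[OF g' v]
    using v by (simp add: compose_eq jD)
  finally show "res (compose (carrier E) g g') v = compose (carrier W) (res g) (res g') v"
    by (rule sym)
qed (simp_all add: res_def)

text \<open>
  An automorphism fixes the unity, hence is determined by its values on \<open>j W\<close>.
\<close>

lemma res_inj: "inj_on res (carrier (algebra_aut_group R E))"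
proof (rule inj_onI)
  fix g g' assume g: "g \<in> carrier (algebra_aut_group R E)"
    and g': "g' \<in> carrier (algebra_aut_group R E)" and eq: "res g = res g'"
  show "g = g'"
  proof (rule extensionalityI[of _ "carrier E"])
    show "g \<in> extensional (carrier E)" "g' \<in> extensional (carrier E)"
      using aut_bij[OF g] aut_bij[OF g'] by (simp_all add: Bij_def)
    fix u assume u: "u \<in> carrier E"
    have *: "f u = t u \<odot>\<^bsub>E\<^esub> \<one>\<^bsub>E\<^esub> \<oplus>\<^bsub>E\<^esub> j (res f (p u))"
      if f: "f \<in> carrier (algebra_aut_group R E)" for f
    proof -
      have "f u = f (t u \<odot>\<^bsub>E\<^esub> \<one>\<^bsub>E\<^esub> \<oplus>\<^bsub>E\<^esub> j (p u))"
        by (rule arg_cong[OF decomposition[OF u]])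
      then show ?thesis
        using u by (simp add: gD[OF f] jD one_closed aut_one[OF f] j_res[OF f] tD pD)
    qed
    show "g u = g' u" using *[OF g] *[OF g'] eq by simp
  qed
qed

text \<open>
  An isometry \<open>h\<close> extends to \<open>a 1 + j v \<mapsto> a 1 + j (h v)\<close>, which is multiplicative because the product
  formula involves \<open>W\<close> only through \<open>\<beta>\<close> and the module structure.
\<close>

lemma res_surj:
  assumes h: "h \<in> carrier (isometry_group R W \<beta>)"
  shows "\<exists>g\<in>carrier (algebra_aut_group R E). res g = h"
proof -
  have bij: "h \<in> Bij (carrier W)" and lin: "linear_map R W W h"
    and iso: "\<And>v w. \<lbrakk>v \<in> carrier W; w \<in> carrier W\<rbrakk> \<Longrightarrow> \<beta> (h v) (h w) = \<beta> v w"
    using h by (auto simp: carrier_isometry_group)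
  note hD = linear_mapD[OF lin]
  define g where "g = (\<lambda>u\<in>carrier E. t u \<odot>\<^bsub>E\<^esub> \<one>\<^bsub>E\<^esub> \<oplus>\<^bsub>E\<^esub> j (h (p u)))"
  have closed: "g u \<in> carrier E" and tg: "t (g u) = t u" and pg: "p (g u) = h (p u)"
    if "u \<in> carrier E" for u
    using that by (simp_all add: g_def one_closed tD pD jD hD t_one p_one t_j p_j)
  have "linear_map R E E g"
    unfolding linear_map_def
    by (safe; (rule coordinates_eqI)?; simp add: closed tg pg tD pD hD)
  moreover have "g (u \<otimes>\<^bsub>E\<^esub> v) = g u \<otimes>\<^bsub>E\<^esub> g v" if "u \<in> carrier E" "v \<in> carrier E" for u v
    by (rule coordinates_eqI)
      (simp_all add: that closed tg pg mult_closed t_mult p_mult tD pD hD iso)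
  moreover have "g \<in> Bij (carrier E)"
  proof -
    have "inj_on g (carrier E)"
    proof (rule inj_onI)
      fix u v assume u: "u \<in> carrier E" and v: "v \<in> carrier E" and eq: "g u = g v"
      have "h (p u) = h (p v)" using pg u v eq by metis
      then have "p u = p v"
        using bij u v pD(1) by (metis Bij_inv(3))
      moreover have "t u = t v" using tg u v eq by metis
      ultimately show "u = v" using u v by (metis coordinates_eqI)
    qed
    moreover have "g ` carrier E = carrier E"
    proof
      show "g ` carrier E \<subseteq> carrier E" using closed by blast
      show "carrier E \<subseteq> g ` carrier E"
      proof
        fix u assume u: "u \<in> carrier E"
        let ?w = "inv_into (carrier W) h (p u)"
        have w: "?w \<in> carrier W" "h ?w = p u" using Bij_inv[OF bij] u pD by auto
        let ?u' = "t u \<odot>\<^bsub>E\<^esub> \<one>\<^bsub>E\<^esub> \<oplus>\<^bsub>E\<^esub> j ?w"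
        have u': "?u' \<in> carrier E" using u w by (simp add: one_closed tD jD)
        have "g ?u' = u"
          by (rule coordinates_eqI) (simp_all add: u w u' closed tg pg t_sum p_sum tD)
        then show "u \<in> g ` carrier E" using u' by (metis image_eqI)
      qed
    qed
    ultimately show ?thesis by (simp add: Bij_def bij_betw_def g_def)
  qed
  ultimately have g: "g \<in> carrier (algebra_aut_group R E)"
    by (simp add: carrier_algebra_aut_group)
  have "res g = h"
  proof (rule extensionalityI[of _ "carrier W"])
    show "res g \<in> extensional (carrier W)" by (simp add: res_def)
    show "h \<in> extensional (carrier W)" using bij by (simp add: Bij_def)
    show "res g v = h v" if "v \<in> carrier W" for v
      using that by (simp add: res_eq[OF g] pg jD p_j)
  qed
  with g show ?thesis by blast
qed

theorem res_iso: "res \<in> iso (algebra_aut_group R E) (isometry_group R W \<beta>)"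
proof (rule isoI)
  show "res \<in> hom (algebra_aut_group R E) (isometry_group R W \<beta>)"
    by (rule homI)
      (simp_all add: res_isometry mult_algebra_aut_group mult_isometry_group res_compose)
  show "bij_betw res (carrier (algebra_aut_group R E)) (carrier (isometry_group R W \<beta>))"
    using res_inj res_isometry res_surj by (fastforce simp: bij_betw_def)
qed

end


section \<open>Extension of scalars\<close>

text \<open>
  Oriented against the definition of \<open>base_change\<close>: the universal property speaks of the
  multiplicative group, everything after it of the additive module.
\<close>

lemma tensor_group_base_change [simp]:
  "carrier (tensor_group F M R) = carrier (base_change F M R)"
  "monoid.mult (tensor_group F M R) = ring.add (base_change F M R)"
  "monoid.one (tensor_group F M R) = ring.zero (base_change F M R)"
  by (simp_all add: base_change_def)

lemma frag_keys:
  assumes "Poly_Mapping.keys a \<subseteq> S" "Poly_Mapping.keys b \<subseteq> S"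
  shows frag_diff: "Poly_Mapping.keys (a - b) \<subseteq> S" and frag_add: "Poly_Mapping.keys (a + b) \<subseteq> S"
  using assms keys_diff[of a b] keys_add[of a b] by blast+

locale scalar_extension = M: module F M + R: algebra F R
  for F (structure) and M (structure) and R (structure)
begin

abbreviation MR where "MR \<equiv> base_change F M R"
abbreviation pure where "pure \<equiv> pure_tensor F M R"
abbreviation lift where "lift G \<equiv> tensor_lift F M R G"
abbreviation balanced where "balanced G \<equiv> balanced_map F M R G"

lemma M_module: "module F M" by (rule M.module_axioms)
lemma R_module: "module F R" by (rule R.module_axioms)

lemma comm_group_tensor: "comm_group (tensor_group F M R)"
  by (rule tensor_comm_group[OF M_module R_module])

lemma abelian_group_MR: "abelian_group MR"
proof -
  interpret T: comm_group "tensor_group F M R" by (rule comm_group_tensor)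
  show ?thesis
  proof (rule abelian_groupI)
    show "\<exists>y\<in>carrier MR. y \<oplus>\<^bsub>MR\<^esub> x = \<zero>\<^bsub>MR\<^esub>" if "x \<in> carrier MR" for x
      using that T.l_inv[of x] T.inv_closed[of x] by auto
  qed (use T.m_closed T.one_closed T.m_assoc T.m_comm T.l_one in auto)
qed

sublocale MR: abelian_group MR by (rule abelian_group_MR)

lemma pure_closed [simp, intro]: "\<lbrakk>x \<in> carrier M; r \<in> carrier R\<rbrakk> \<Longrightarrow> pure x r \<in> carrier MR"
  unfolding tensor_group_base_change(1)[symmetric]
  by (auto simp: tensor_group_def pure_tensor_def carrier_FactGroup
      simp del: tensor_group_base_change)

text \<open>
  The differences of the two sides are the generators of the subgroup that is divided out.
\<close>

lemma pure_relations:
  shows pure_add_left: "\<lbrakk>x \<in> carrier M; y \<in> carrier M; r \<in> carrier R\<rbrakk> \<Longrightarrow>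
      pure (x \<oplus>\<^bsub>M\<^esub> y) r = pure x r \<oplus>\<^bsub>MR\<^esub> pure y r"
    and pure_add_right: "\<lbrakk>x \<in> carrier M; r \<in> carrier R; s \<in> carrier R\<rbrakk> \<Longrightarrow>
      pure x (r \<oplus>\<^bsub>R\<^esub> s) = pure x r \<oplus>\<^bsub>MR\<^esub> pure x s"
    and pure_smult: "\<lbrakk>c \<in> carrier F; x \<in> carrier M; r \<in> carrier R\<rbrakk> \<Longrightarrow>
      pure (c \<odot>\<^bsub>M\<^esub> x) r = pure x (c \<odot>\<^bsub>R\<^esub> r)"
proof -
  let ?Fr = "free_Abelian_group (carrier M \<times> carrier R)"
  let ?N = "tensor_subgroup F M R"
  let ?k = "\<lambda>c. ?N #>\<^bsub>?Fr\<^esub> c"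
  interpret N: normal ?N ?Fr by (rule tensor_subgroup_normal[OF M_module R_module])
  interpret T: comm_group "tensor_group F M R" by (rule comm_group_tensor)
  interpret k: group_hom ?Fr "tensor_group F M R" ?k
    using pure_tensor_hom[OF M_module R_module]
    by (intro group_hom.intro group_hom_axioms.intro) auto
  have rel: "?k c = \<zero>\<^bsub>MR\<^esub>" if "c \<in> tensor_relations F M R" for c
  proof -
    have "c \<in> ?N" using that by (simp add: tensor_subgroup_def generate.incl)
    then have "?k c = ?N" by (simp add: N.rcos_const N.subgroup_axioms)
    also have "?N = \<one>\<^bsub>tensor_group F M R\<^esub>" by (simp add: tensor_group_def FactGroup_def del: tensor_group_base_change)
    finally show ?thesis by simp
  qed
  have kdiff: "?k (a - b) \<oplus>\<^bsub>MR\<^esub> ?k b = ?k a" if "a \<in> carrier ?Fr" "b \<in> carrier ?Fr" for a b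
    using k.hom_mult[of "a - b" b] that frag_diff[of a "carrier M \<times> carrier R" b] by (simp del: k.hom_mult)
  have zero: "?k a = ?k b" if "?k (a - b) = \<zero>\<^bsub>MR\<^esub>" "a \<in> carrier ?Fr" "b \<in> carrier ?Fr" for a b
    using kdiff[of a b] k.hom_closed[of b] that by simp
  {
    fix x y r assume m: "x \<in> carrier M" "y \<in> carrier M" "r \<in> carrier R"
    let ?a = "frag_of (x \<oplus>\<^bsub>M\<^esub> y, r)" and ?b = "frag_of (x, r) + frag_of (y, r)"
    have "?a - ?b \<in> tensor_relations F M R"
      using m unfolding tensor_relations_def by (auto simp: algebra_simps)
    then have "?k ?a = ?k ?b"
      using m by (intro zero rel) (simp_all add: frag_add)
    also have "\<dots> = ?k (frag_of (x, r)) \<oplus>\<^bsub>MR\<^esub> ?k (frag_of (y, r))"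
      using k.hom_mult[of "frag_of (x, r)" "frag_of (y, r)"] m by auto
    finally show "pure (x \<oplus>\<^bsub>M\<^esub> y) r = pure x r \<oplus>\<^bsub>MR\<^esub> pure y r"
      by (simp add: pure_tensor_def)
  }
  {
    fix x r s assume m: "x \<in> carrier M" "r \<in> carrier R" "s \<in> carrier R"
    let ?a = "frag_of (x, r \<oplus>\<^bsub>R\<^esub> s)" and ?b = "frag_of (x, r) + frag_of (x, s)"
    have "?a - ?b \<in> tensor_relations F M R"
      using m unfolding tensor_relations_def by (auto simp: algebra_simps)
    then have "?k ?a = ?k ?b"
      using m by (intro zero rel) (simp_all add: frag_add)
    also have "\<dots> = ?k (frag_of (x, r)) \<oplus>\<^bsub>MR\<^esub> ?k (frag_of (x, s))"
      using k.hom_mult[of "frag_of (x, r)" "frag_of (x, s)"] m by auto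
    finally show "pure x (r \<oplus>\<^bsub>R\<^esub> s) = pure x r \<oplus>\<^bsub>MR\<^esub> pure x s"
      by (simp add: pure_tensor_def)
  }
  {
    fix c x r assume m: "c \<in> carrier F" "x \<in> carrier M" "r \<in> carrier R"
    have "frag_of (c \<odot>\<^bsub>M\<^esub> x, r) - frag_of (x, c \<odot>\<^bsub>R\<^esub> r) \<in> tensor_relations F M R"
      using m unfolding tensor_relations_def by blast
    then have "?k (frag_of (c \<odot>\<^bsub>M\<^esub> x, r)) = ?k (frag_of (x, c \<odot>\<^bsub>R\<^esub> r))"
      using m by (intro zero rel) auto
    then show "pure (c \<odot>\<^bsub>M\<^esub> x) r = pure x (c \<odot>\<^bsub>R\<^esub> r)"
      by (simp add: pure_tensor_def)
  }
qed

lemma pure_zero [simp]: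
  shows pure_zero_left: "r \<in> carrier R \<Longrightarrow> pure \<zero>\<^bsub>M\<^esub> r = \<zero>\<^bsub>MR\<^esub>"
    and pure_zero_right: "x \<in> carrier M \<Longrightarrow> pure x \<zero>\<^bsub>R\<^esub> = \<zero>\<^bsub>MR\<^esub>"
  using pure_add_left[of "\<zero>\<^bsub>M\<^esub>" "\<zero>\<^bsub>M\<^esub>" r] pure_add_right[of x "\<zero>\<^bsub>R\<^esub>" "\<zero>\<^bsub>R\<^esub>"]
  by (simp_all add: MR.add.r_cancel_one)

lemma balancedI:
  assumes "\<And>x r. \<lbrakk>x \<in> carrier M; r \<in> carrier R\<rbrakk> \<Longrightarrow> f x r \<in> carrier G"
    and "\<And>x y r. \<lbrakk>x \<in> carrier M; y \<in> carrier M; r \<in> carrier R\<rbrakk> \<Longrightarrow>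
      f (x \<oplus>\<^bsub>M\<^esub> y) r = f x r \<otimes>\<^bsub>G\<^esub> f y r"
    and "\<And>x r s. \<lbrakk>x \<in> carrier M; r \<in> carrier R; s \<in> carrier R\<rbrakk> \<Longrightarrow>
      f x (r \<oplus>\<^bsub>R\<^esub> s) = f x r \<otimes>\<^bsub>G\<^esub> f x s"
    and "\<And>c x r. \<lbrakk>c \<in> carrier F; x \<in> carrier M; r \<in> carrier R\<rbrakk> \<Longrightarrow>
      f (c \<odot>\<^bsub>M\<^esub> x) r = f x (c \<odot>\<^bsub>R\<^esub> r)"
  shows "balanced G f"
  unfolding balanced_map_def by (intro conjI ballI assms)

lemma balancedD:
  assumes "balanced G f"
  shows "\<lbrakk>x \<in> carrier M; r \<in> carrier R\<rbrakk> \<Longrightarrow> f x r \<in> carrier G"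
    and "\<lbrakk>x \<in> carrier M; y \<in> carrier M; r \<in> carrier R\<rbrakk> \<Longrightarrow>
      f (x \<oplus>\<^bsub>M\<^esub> y) r = f x r \<otimes>\<^bsub>G\<^esub> f y r"
    and "\<lbrakk>x \<in> carrier M; r \<in> carrier R; s \<in> carrier R\<rbrakk> \<Longrightarrow>
      f x (r \<oplus>\<^bsub>R\<^esub> s) = f x r \<otimes>\<^bsub>G\<^esub> f x s"
    and "\<lbrakk>c \<in> carrier F; x \<in> carrier M; r \<in> carrier R\<rbrakk> \<Longrightarrow>
      f (c \<odot>\<^bsub>M\<^esub> x) r = f x (c \<odot>\<^bsub>R\<^esub> r)"
  using assms by (simp_all add: balanced_map_def)

text \<open>
  Every element is a finite sum of pure tensors.  Differences need no separate case since
  \<open>- (x \<otimes> r) = (- x) \<otimes> r\<close>; the induction over the free abelian group therefore carries the negative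
  along.
\<close>

lemma tensor_induct [consumes 1, case_names pure add]:
  assumes u: "u \<in> carrier MR"
    and pure: "\<And>x r. \<lbrakk>x \<in> carrier M; r \<in> carrier R\<rbrakk> \<Longrightarrow> P (pure x r)"
    and add: "\<And>v w. \<lbrakk>v \<in> carrier MR; w \<in> carrier MR; P v; P w\<rbrakk> \<Longrightarrow> P (v \<oplus>\<^bsub>MR\<^esub> w)"
  shows "P u"
proof -
  let ?Fr = "free_Abelian_group (carrier M \<times> carrier R)"
  let ?k = "\<lambda>c. tensor_subgroup F M R #>\<^bsub>?Fr\<^esub> c"
  interpret T: comm_group "tensor_group F M R" by (rule comm_group_tensor)
  interpret Fr: comm_group ?Fr by (rule abelian_free_Abelian_group)
  interpret k: group_hom ?Fr "tensor_group F M R" ?k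
    using pure_tensor_hom[OF M_module R_module]
    by (intro group_hom.intro group_hom_axioms.intro) auto
  have closed: "?k c \<in> carrier MR" if "Poly_Mapping.keys c \<subseteq> carrier M \<times> carrier R" for c
    using k.hom_closed[of c] that by simp
  have P_zero: "P \<zero>\<^bsub>MR\<^esub>"
    using pure[of "\<zero>\<^bsub>M\<^esub>" "\<zero>\<^bsub>R\<^esub>"] by simp
  have P_minus: "P (\<ominus>\<^bsub>MR\<^esub> pure x r)" if m: "x \<in> carrier M" "r \<in> carrier R" for x r
  proof -
    have "pure (\<ominus>\<^bsub>M\<^esub> x) r \<oplus>\<^bsub>MR\<^esub> pure x r = \<zero>\<^bsub>MR\<^esub>"
      using pure_add_left[of "\<ominus>\<^bsub>M\<^esub> x" x r] m by (simp add: M.M.l_neg)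
    then have "\<ominus>\<^bsub>MR\<^esub> pure x r = pure (\<ominus>\<^bsub>M\<^esub> x) r"
      using m by (intro MR.minus_equality) auto
    then show ?thesis using pure m by simp
  qed
  have "P (?k c) \<and> P (\<ominus>\<^bsub>MR\<^esub> ?k c)" if "Poly_Mapping.keys c \<subseteq> carrier M \<times> carrier R" for c
    using that
  proof (induction c rule: free_Abelian_group_induct[consumes 1, case_names zero diff gen])
    case zero
    have "\<ominus>\<^bsub>MR\<^esub> \<zero>\<^bsub>MR\<^esub> = \<zero>\<^bsub>MR\<^esub>" by (intro MR.minus_equality) auto
    moreover have "?k 0 = \<zero>\<^bsub>MR\<^esub>" using k.hom_one by simp
    ultimately show ?case using P_zero by metis
  next
    case (diff x y)
    have "?k (x - y) \<oplus>\<^bsub>MR\<^esub> ?k y = ?k x"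
      using k.hom_mult[of "x - y" y] diff.hyps frag_diff[of x "carrier M \<times> carrier R" y] by (simp del: k.hom_mult)
    then have *: "?k (x - y) = ?k x \<oplus>\<^bsub>MR\<^esub> (\<ominus>\<^bsub>MR\<^esub> ?k y)"
      using closed diff.hyps closed[OF frag_diff[of x _ y]] by (metis MR.add.inv_solve_right)
    have "\<ominus>\<^bsub>MR\<^esub> ?k (x - y) = ?k y \<oplus>\<^bsub>MR\<^esub> (\<ominus>\<^bsub>MR\<^esub> ?k x)"
      unfolding * using closed diff.hyps by (simp add: MR.minus_add MR.a_comm)
    then show ?case using * diff.IH closed diff.hyps add by simp
  next
    case (gen a)
    then show ?case using pure P_minus by (cases a) (auto simp: pure_tensor_def)
  qed
  moreover obtain c where "c \<in> carrier ?Fr" "u = ?k c"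
    using u unfolding tensor_group_base_change(1)[symmetric]
    by (auto simp: tensor_group_def carrier_FactGroup simp del: tensor_group_base_change)
  ultimately show ?thesis by simp
qed

lemma lift_spec:
  assumes "comm_group G" "balanced G f"
  shows "lift G f \<in> hom (tensor_group F M R) G \<and> lift G f \<in> extensional (carrier MR) \<and>
    (\<forall>x\<in>carrier M. \<forall>r\<in>carrier R. lift G f (pure x r) = f x r)"
  using theI'[OF tensor_universal_property[OF M_module R_module assms]]
  unfolding tensor_lift_def by simp

lemma
  assumes "comm_group G" "balanced G f"
  shows lift_closed: "u \<in> carrier MR \<Longrightarrow> lift G f u \<in> carrier G"
    and lift_add: "\<lbrakk>u \<in> carrier MR; v \<in> carrier MR\<rbrakk> \<Longrightarrow>
      lift G f (u \<oplus>\<^bsub>MR\<^esub> v) = lift G f u \<otimes>\<^bsub>G\<^esub> lift G f v"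
    and lift_extensional: "lift G f \<in> extensional (carrier MR)"
    and lift_pure: "\<lbrakk>x \<in> carrier M; r \<in> carrier R\<rbrakk> \<Longrightarrow> lift G f (pure x r) = f x r"
  using lift_spec[OF assms] by (auto simp: hom_def)

lemma R_smult_mult:
  assumes "c \<in> carrier F" "r \<in> carrier R" "s \<in> carrier R"
  shows "r \<otimes>\<^bsub>R\<^esub> (c \<odot>\<^bsub>R\<^esub> s) = c \<odot>\<^bsub>R\<^esub> (r \<otimes>\<^bsub>R\<^esub> s)"
  using assms R.smult_assoc2[of c s r] by (simp add: R.m_comm)

lemma balanced_smult:
  assumes r: "r \<in> carrier R"
  shows "balanced (tensor_group F M R) (\<lambda>x s. pure x (r \<otimes>\<^bsub>R\<^esub> s))"
  using r by (intro balancedI) (simp_all add: pure_add_left pure_add_right R.r_distr pure_smult R_smult_mult)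

lemma smult_MR:
  "smult MR r = lift (tensor_group F M R) (\<lambda>x s. pure x (r \<otimes>\<^bsub>R\<^esub> s))"
  by (simp add: base_change_def del: tensor_group_base_change)

lemma smult_pure [simp]:
  "\<lbrakk>r \<in> carrier R; x \<in> carrier M; s \<in> carrier R\<rbrakk> \<Longrightarrow> r \<odot>\<^bsub>MR\<^esub> pure x s = pure x (r \<otimes>\<^bsub>R\<^esub> s)"
  by (simp add: smult_MR lift_pure[OF comm_group_tensor balanced_smult])

lemma smult_MR_closed: "\<lbrakk>r \<in> carrier R; u \<in> carrier MR\<rbrakk> \<Longrightarrow> r \<odot>\<^bsub>MR\<^esub> u \<in> carrier MR"
  using lift_closed[OF comm_group_tensor balanced_smult] by (simp add: smult_MR)

lemma smult_MR_add: "\<lbrakk>r \<in> carrier R; u \<in> carrier MR; v \<in> carrier MR\<rbrakk> \<Longrightarrow>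
    r \<odot>\<^bsub>MR\<^esub> (u \<oplus>\<^bsub>MR\<^esub> v) = r \<odot>\<^bsub>MR\<^esub> u \<oplus>\<^bsub>MR\<^esub> r \<odot>\<^bsub>MR\<^esub> v"
  using lift_add[OF comm_group_tensor balanced_smult] by (simp add: smult_MR)

lemma module_MR: "module R MR"
proof (rule moduleI)
  show "cring R" by (rule R.M_cring)
  show "abelian_group MR" by (rule abelian_group_MR)
next
  fix a b u
  assume a: "a \<in> carrier R" and b: "b \<in> carrier R" and u: "u \<in> carrier MR"
  show "(a \<oplus>\<^bsub>R\<^esub> b) \<odot>\<^bsub>MR\<^esub> u = a \<odot>\<^bsub>MR\<^esub> u \<oplus>\<^bsub>MR\<^esub> b \<odot>\<^bsub>MR\<^esub> u"
    using u
  proof (induction rule: tensor_induct)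
    case (pure x r)
    then show ?case using a b by (simp add: R.l_distr pure_add_right)
  next
    case (add v w)
    then show ?case using a b
      by (simp add: smult_MR_add smult_MR_closed MR.a_ac)
  qed
  show "(a \<otimes>\<^bsub>R\<^esub> b) \<odot>\<^bsub>MR\<^esub> u = a \<odot>\<^bsub>MR\<^esub> (b \<odot>\<^bsub>MR\<^esub> u)"
    using u
    by (induction rule: tensor_induct)
      (use a b in \<open>simp_all add: R.m_assoc smult_MR_add smult_MR_closed\<close>)
next
  fix u assume "u \<in> carrier MR"
  then show "\<one>\<^bsub>R\<^esub> \<odot>\<^bsub>MR\<^esub> u = u"
    by (induction rule: tensor_induct) (simp_all add: smult_MR_add)
qed (simp_all add: smult_MR_closed smult_MR_add)

text \<open>
  Linear maps and functionals both come from a balanced map whose second argument can be scaled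
  through an endomorphism \<open>\<sigma>\<close> of the target.  Taking \<open>\<sigma>\<close> abstract avoids viewing the ring \<open>R\<close> as a module
  record over itself.
\<close>

lemma lift_semilinear:
  assumes G: "comm_group G" and f: "balanced G f" and r: "r \<in> carrier R"
    and \<sigma>: "\<sigma> \<in> hom G G"
    and eq: "\<And>x s. \<lbrakk>x \<in> carrier M; s \<in> carrier R\<rbrakk> \<Longrightarrow> f x (r \<otimes>\<^bsub>R\<^esub> s) = \<sigma> (f x s)"
    and u: "u \<in> carrier MR"
  shows "lift G f (r \<odot>\<^bsub>MR\<^esub> u) = \<sigma> (lift G f u)"
  using u
proof (induction rule: tensor_induct)
  case (pure x s)
  then show ?case using r by (simp add: lift_pure[OF G f] eq)
next
  case (add v w)
  then show ?case
    using r by (simp add: smult_MR_add smult_MR_closed lift_add[OF G f] hom_mult[OF \<sigma>] lift_closed[OF G f])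
qed

lemma lift_linear_map:
  assumes N: "module R N" and G: "comm_group G" "carrier G = carrier N" "monoid.mult G = ring.add N"
    and f: "balanced G f"
    and eq: "\<And>r x s. \<lbrakk>r \<in> carrier R; x \<in> carrier M; s \<in> carrier R\<rbrakk> \<Longrightarrow>
      f x (r \<otimes>\<^bsub>R\<^esub> s) = r \<odot>\<^bsub>N\<^esub> f x s"
  shows "linear_map R MR N (lift G f)"
proof -
  interpret N: module R N by (rule N)
  have "lift G f (r \<odot>\<^bsub>MR\<^esub> u) = r \<odot>\<^bsub>N\<^esub> lift G f u" if "r \<in> carrier R" "u \<in> carrier MR" for r u
    by (rule lift_semilinear[OF G(1) f that(1) _ _ that(2)])
      (auto simp: hom_def G that N.smult_r_distr eq)
  then show ?thesis
    using lift_closed[OF G(1) f] lift_add[OF G(1) f] by (simp add: linear_map_def G)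
qed

lemma comm_group_add_R: "comm_group (add_monoid R)"
  using R.M.a_comm_group .

lemma lift_linear_functional:
  assumes f: "balanced (add_monoid R) f"
    and eq: "\<And>r x s. \<lbrakk>r \<in> carrier R; x \<in> carrier M; s \<in> carrier R\<rbrakk> \<Longrightarrow>
      f x (r \<otimes>\<^bsub>R\<^esub> s) = r \<otimes>\<^bsub>R\<^esub> f x s"
  shows "linear_functional R MR (lift (add_monoid R) f)"
proof -
  have "lift (add_monoid R) f (r \<odot>\<^bsub>MR\<^esub> u) = r \<otimes>\<^bsub>R\<^esub> lift (add_monoid R) f u"
    if "r \<in> carrier R" "u \<in> carrier MR" for r u
    by (rule lift_semilinear[OF comm_group_add_R f that(1) _ _ that(2)])
      (auto simp: hom_def that R.r_distr eq)
  then show ?thesis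
    using lift_closed[OF comm_group_add_R f] lift_add[OF comm_group_add_R f]
    by (simp add: linear_functional_def)
qed

text \<open>
  Both the product and the bilinear form on a scalar extension are two nested lifts; the following
  facts reduce statements about them to pure tensors.
\<close>

context
  fixes G :: "('g, 'l) monoid_scheme" and f
  assumes G: "comm_group G"
    and f1: "\<And>y s. \<lbrakk>y \<in> carrier M; s \<in> carrier R\<rbrakk> \<Longrightarrow> balanced G (\<lambda>x r. f x r y s)"
    and f2: "\<And>x r. \<lbrakk>x \<in> carrier M; r \<in> carrier R\<rbrakk> \<Longrightarrow> balanced G (f x r)"
begin

lemma balanced_inner:
  assumes v: "v \<in> carrier MR"
  shows "balanced G (\<lambda>x r. lift G (f x r) v)"
proof -
  interpret G: comm_group G by (rule G)
  note L = lift_closed[OF G f2] lift_add[OF G f2] lift_pure[OF G f2]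
  show ?thesis
    using v
  proof (induction rule: tensor_induct)
    case (pure y s)
    show ?case
      by (intro balancedI) (simp_all add: L pure balancedD[OF f1[OF pure]])
  next
    case (add v w)
    note B = balancedD(2-4)[OF add.IH(1)] balancedD(2-4)[OF add.IH(2)]
    show ?case
      by (intro balancedI) (simp_all add: L add.hyps B G.m_ac)
  qed
qed

lemmas bilift_rules = lift_closed[OF G balanced_inner] lift_add[OF G balanced_inner]
  lift_pure[OF G balanced_inner]

lemma bilift_closed: "\<lbrakk>u \<in> carrier MR; v \<in> carrier MR\<rbrakk> \<Longrightarrow>
    lift G (\<lambda>x r. lift G (f x r) v) u \<in> carrier G"
  by (rule bilift_rules)

lemma bilift_add_left: "\<lbrakk>u \<in> carrier MR; u' \<in> carrier MR; v \<in> carrier MR\<rbrakk> \<Longrightarrow>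
    lift G (\<lambda>x r. lift G (f x r) v) (u \<oplus>\<^bsub>MR\<^esub> u') =
    lift G (\<lambda>x r. lift G (f x r) v) u \<otimes>\<^bsub>G\<^esub> lift G (\<lambda>x r. lift G (f x r) v) u'"
  by (rule bilift_rules)

lemma bilift_add_right:
  assumes u: "u \<in> carrier MR" and v: "v \<in> carrier MR" and v': "v' \<in> carrier MR"
  shows "lift G (\<lambda>x r. lift G (f x r) (v \<oplus>\<^bsub>MR\<^esub> v')) u =
    lift G (\<lambda>x r. lift G (f x r) v) u \<otimes>\<^bsub>G\<^esub> lift G (\<lambda>x r. lift G (f x r) v') u"
proof -
  interpret G: comm_group G by (rule G)
  show ?thesis
    using u
  proof (induction rule: tensor_induct)
    case (pure x r)
    then show ?case using v v' by (simp add: bilift_rules lift_add[OF G f2])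
  next
    case (add u u')
    then show ?case using v v' by (simp add: bilift_rules G.m_ac)
  qed
qed

lemma bilift_pure: "\<lbrakk>x \<in> carrier M; r \<in> carrier R; y \<in> carrier M; s \<in> carrier R\<rbrakk> \<Longrightarrow>
    lift G (\<lambda>x r. lift G (f x r) (pure y s)) (pure x r) = f x r y s"
  by (simp add: bilift_rules lift_pure[OF G f2])

end

lemma tensor_induct2 [consumes 2, case_names pure add_left add_right]:
  assumes "u \<in> carrier MR" "v \<in> carrier MR"
    and "\<And>x r y s. \<lbrakk>x \<in> carrier M; r \<in> carrier R; y \<in> carrier M; s \<in> carrier R\<rbrakk> \<Longrightarrow>
      P (pure x r) (pure y s)"
    and "\<And>u u' v. \<lbrakk>u \<in> carrier MR; u' \<in> carrier MR; v \<in> carrier MR; P u v; P u' v\<rbrakk> \<Longrightarrow>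
      P (u \<oplus>\<^bsub>MR\<^esub> u') v"
    and "\<And>u v v'. \<lbrakk>u \<in> carrier MR; v \<in> carrier MR; v' \<in> carrier MR; P u v; P u v'\<rbrakk> \<Longrightarrow>
      P u (v \<oplus>\<^bsub>MR\<^esub> v')"
  shows "P u v"
  using assms(1)
proof (induction rule: tensor_induct)
  case (pure x r)
  show ?case using assms(2)
    by (induction rule: tensor_induct) (use pure assms(3,5) in auto)
qed (use assms(2,4) in blast)

end


section \<open>Functionals on vector spaces\<close>

text \<open>
  By Zorn's lemma there is a subspace \<open>N\<close> maximal among those that avoid \<open>e\<close>.  Maximality forces
  \<open>V = N \<oplus> F e\<close>, and the functional is the coefficient of \<open>e\<close>.
\<close>

lemma exists_functional:
  fixes F (structure) and V (structure)
  assumes V: "module F V" and F: "field F" and e: "e \<in> carrier V" "e \<noteq> \<zero>\<^bsub>V\<^esub>"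
  shows "\<exists>l. linear_functional F V l \<and> l e = \<one>\<^bsub>F\<^esub>"
proof -
  interpret V: module F V by (rule V)
  interpret F: field F by (rule F)
  define \<A> where "\<A> = {N. submodule N F V \<and> e \<notin> N}"
  have "\<exists>N\<in>\<A>. \<forall>X\<in>\<A>. N \<subseteq> X \<longrightarrow> X = N"
  proof (rule subset_Zorn_nonempty)
    have "submodule {\<zero>\<^bsub>V\<^esub>} F V"
      by (rule V.submoduleI) (auto intro: V.M.minus_equality)
    then show "\<A> \<noteq> {}" using e by (auto simp: \<A>_def)
  next
    fix C assume "C \<noteq> {}" and chain: "subset.chain \<A> C"
    then obtain N0 where N0: "N0 \<in> C" by blast
    have C: "\<And>N. N \<in> C \<Longrightarrow> submodule N F V \<and> e \<notin> N"
      and total: "\<And>N N'. \<lbrakk>N \<in> C; N' \<in> C\<rbrakk> \<Longrightarrow> N \<subseteq> N' \<or> N' \<subseteq> N"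
      using chain by (auto simp: \<A>_def subset.chain_def)
    have "submodule (\<Union>C) F V"
    proof (rule V.submoduleI)
      show "\<Union>C \<subseteq> carrier V" using C V.submoduleE(1) by blast
      show "\<zero>\<^bsub>V\<^esub> \<in> \<Union>C"
        using C[OF N0] N0 subgroup.one_closed[OF submodule.axioms(1)] by fastforce
      show "\<ominus>\<^bsub>V\<^esub> a \<in> \<Union>C" if "a \<in> \<Union>C" for a
        using that C V.submoduleE(3) by blast
      show "c \<odot>\<^bsub>V\<^esub> x \<in> \<Union>C" if "c \<in> carrier F" "x \<in> \<Union>C" for c x
        using that C V.submoduleE(4) by blast
      fix a b assume "a \<in> \<Union>C" "b \<in> \<Union>C"
      then obtain N N' where "a \<in> N" "N \<in> C" "b \<in> N'" "N' \<in> C" by blast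
      moreover from this have "N \<subseteq> N' \<or> N' \<subseteq> N" using total by blast
      ultimately show "a \<oplus>\<^bsub>V\<^esub> b \<in> \<Union>C"
        using C V.submoduleE(5) by (metis UnionI subsetD)
    qed
    then show "\<Union>C \<in> \<A>" using C by (auto simp: \<A>_def)
  qed
  then obtain N where N: "submodule N F V" "e \<notin> N"
    and max: "\<And>X. \<lbrakk>submodule X F V; e \<notin> X; N \<subseteq> X\<rbrakk> \<Longrightarrow> X = N"
    by (auto simp: \<A>_def)
  note NE = V.submoduleE[OF N(1)]
  have N_zero: "\<zero>\<^bsub>V\<^esub> \<in> N"
    using subgroup.one_closed[OF submodule.axioms(1)[OF N(1)]] by simp
  have NV: "n \<in> carrier V" if "n \<in> N" for n using that NE(1) by blast
  \<comment> \<open>For \<open>x\<close> outside \<open>N\<close>, the subspace \<open>N + F x\<close> contains \<open>e\<close>, and the coefficient of \<open>x\<close> is invertible.\<close>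
  have span: "\<exists>c\<in>carrier F. \<exists>n\<in>N. x = n \<oplus>\<^bsub>V\<^esub> c \<odot>\<^bsub>V\<^esub> e" if x: "x \<in> carrier V" for x
  proof (cases "x \<in> N")
    case True
    then have "x = x \<oplus>\<^bsub>V\<^esub> \<zero>\<^bsub>F\<^esub> \<odot>\<^bsub>V\<^esub> e" using x e by simp
    then show ?thesis using True by blast
  next
    case False
    define X where "X = {n \<oplus>\<^bsub>V\<^esub> c \<odot>\<^bsub>V\<^esub> x | n c. n \<in> N \<and> c \<in> carrier F}"
    have "submodule X F V"
    proof (rule V.submoduleI)
      show "X \<subseteq> carrier V" using NV x by (auto simp: X_def)
      have "\<zero>\<^bsub>V\<^esub> = \<zero>\<^bsub>V\<^esub> \<oplus>\<^bsub>V\<^esub> \<zero>\<^bsub>F\<^esub> \<odot>\<^bsub>V\<^esub> x" using x by simp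
      then show "\<zero>\<^bsub>V\<^esub> \<in> X" unfolding X_def using N_zero by blast
    next
      fix a assume "a \<in> X"
      then obtain n c where a: "a = n \<oplus>\<^bsub>V\<^esub> c \<odot>\<^bsub>V\<^esub> x" "n \<in> N" "c \<in> carrier F"
        by (auto simp: X_def)
      have "\<ominus>\<^bsub>V\<^esub> a = \<ominus>\<^bsub>V\<^esub> n \<oplus>\<^bsub>V\<^esub> (\<ominus>\<^bsub>F\<^esub> c) \<odot>\<^bsub>V\<^esub> x"
        using a x NV by (simp add: V.M.minus_add V.smult_l_minus)
      then show "\<ominus>\<^bsub>V\<^esub> a \<in> X" unfolding X_def using a NE(3) by blast
      fix d assume d: "d \<in> carrier F"
      have "d \<odot>\<^bsub>V\<^esub> a = d \<odot>\<^bsub>V\<^esub> n \<oplus>\<^bsub>V\<^esub> (d \<otimes>\<^bsub>F\<^esub> c) \<odot>\<^bsub>V\<^esub> x"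
        using a d x NV by (simp add: V.smult_r_distr V.smult_assoc1)
      then show "d \<odot>\<^bsub>V\<^esub> a \<in> X" unfolding X_def using a d NE(4) by blast
    next
      fix a b assume "a \<in> X" "b \<in> X"
      then obtain n c m d where ab: "a = n \<oplus>\<^bsub>V\<^esub> c \<odot>\<^bsub>V\<^esub> x" "n \<in> N" "c \<in> carrier F"
        "b = m \<oplus>\<^bsub>V\<^esub> d \<odot>\<^bsub>V\<^esub> x" "m \<in> N" "d \<in> carrier F"
        by (auto simp: X_def)
      have "a \<oplus>\<^bsub>V\<^esub> b = (n \<oplus>\<^bsub>V\<^esub> m) \<oplus>\<^bsub>V\<^esub> (c \<oplus>\<^bsub>F\<^esub> d) \<odot>\<^bsub>V\<^esub> x"
        using ab x NV by (simp add: V.smult_l_distr V.M.a_ac)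
      then show "a \<oplus>\<^bsub>V\<^esub> b \<in> X" unfolding X_def using ab NE(5) by blast
    qed
    moreover have "N \<subseteq> X"
    proof
      fix n assume n: "n \<in> N"
      have "n = n \<oplus>\<^bsub>V\<^esub> \<zero>\<^bsub>F\<^esub> \<odot>\<^bsub>V\<^esub> x" using n NV x by simp
      then show "n \<in> X" unfolding X_def using n by blast
    qed
    moreover have "x \<in> X"
    proof -
      have "x = \<zero>\<^bsub>V\<^esub> \<oplus>\<^bsub>V\<^esub> \<one>\<^bsub>F\<^esub> \<odot>\<^bsub>V\<^esub> x" using x by simp
      then show ?thesis unfolding X_def using N_zero by blast
    qed
    ultimately have "e \<in> X" using max False by blast
    then obtain n c where nc: "e = n \<oplus>\<^bsub>V\<^esub> c \<odot>\<^bsub>V\<^esub> x" "n \<in> N" "c \<in> carrier F"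
      by (auto simp: X_def)
    have "c \<noteq> \<zero>\<^bsub>F\<^esub>" using nc x NV N(2) by auto
    then have ic: "inv\<^bsub>F\<^esub> c \<in> carrier F" "inv\<^bsub>F\<^esub> c \<otimes>\<^bsub>F\<^esub> c = \<one>\<^bsub>F\<^esub>"
      using nc F.field_Units by auto
    have "\<ominus>\<^bsub>V\<^esub> n \<oplus>\<^bsub>V\<^esub> e = c \<odot>\<^bsub>V\<^esub> x"
      using nc x NV by (simp add: V.M.a_assoc[symmetric] V.M.l_neg)
    then have "inv\<^bsub>F\<^esub> c \<odot>\<^bsub>V\<^esub> (\<ominus>\<^bsub>V\<^esub> n \<oplus>\<^bsub>V\<^esub> e) = x"
      using ic nc x V.smult_assoc1[of "inv\<^bsub>F\<^esub> c" c x] by simp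
    then have "x = inv\<^bsub>F\<^esub> c \<odot>\<^bsub>V\<^esub> (\<ominus>\<^bsub>V\<^esub> n) \<oplus>\<^bsub>V\<^esub> inv\<^bsub>F\<^esub> c \<odot>\<^bsub>V\<^esub> e"
      using ic nc NV e by (simp add: V.smult_r_distr)
    then show ?thesis using NE(3,4) nc ic by blast
  qed
  have unique: "c = d"
    if eq: "n \<oplus>\<^bsub>V\<^esub> c \<odot>\<^bsub>V\<^esub> e = m \<oplus>\<^bsub>V\<^esub> d \<odot>\<^bsub>V\<^esub> e"
      and m: "n \<in> N" "m \<in> N" "c \<in> carrier F" "d \<in> carrier F" for n m c d
  proof (rule ccontr)
    assume "c \<noteq> d"
    define k where "k = c \<ominus>\<^bsub>F\<^esub> d"
    have k: "k \<in> carrier F" "k \<noteq> \<zero>\<^bsub>F\<^esub>"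
      using \<open>c \<noteq> d\<close> m V.R.minus_equality[of c "\<ominus>\<^bsub>F\<^esub> d"] by (auto simp: k_def a_minus_def)
    then have ik: "inv\<^bsub>F\<^esub> k \<in> carrier F" "inv\<^bsub>F\<^esub> k \<otimes>\<^bsub>F\<^esub> k = \<one>\<^bsub>F\<^esub>"
      using F.field_Units by auto
    have "k \<odot>\<^bsub>V\<^esub> e = c \<odot>\<^bsub>V\<^esub> e \<oplus>\<^bsub>V\<^esub> \<ominus>\<^bsub>V\<^esub> (d \<odot>\<^bsub>V\<^esub> e)"
      using m e by (simp add: k_def a_minus_def V.smult_l_distr V.smult_l_minus)
    also have "c \<odot>\<^bsub>V\<^esub> e = \<ominus>\<^bsub>V\<^esub> n \<oplus>\<^bsub>V\<^esub> (m \<oplus>\<^bsub>V\<^esub> d \<odot>\<^bsub>V\<^esub> e)"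
      unfolding eq[symmetric] using m e NV by (simp add: V.M.a_assoc[symmetric] V.M.l_neg)
    also have "\<dots> \<oplus>\<^bsub>V\<^esub> \<ominus>\<^bsub>V\<^esub> (d \<odot>\<^bsub>V\<^esub> e) = \<ominus>\<^bsub>V\<^esub> n \<oplus>\<^bsub>V\<^esub> m"
      using m e NV by (simp add: V.M.a_assoc V.M.r_neg)
    finally have "k \<odot>\<^bsub>V\<^esub> e \<in> N" using m NE(3,5) by simp
    then have "inv\<^bsub>F\<^esub> k \<odot>\<^bsub>V\<^esub> (k \<odot>\<^bsub>V\<^esub> e) \<in> N" using ik NE(4) by blast
    then have "e \<in> N"
      using V.smult_assoc1[of "inv\<^bsub>F\<^esub> k" k e] ik k e by simp
    then show False using N(2) by contradiction
  qed
  define l where "l x = (THE c. c \<in> carrier F \<and> (\<exists>n\<in>N. x = n \<oplus>\<^bsub>V\<^esub> c \<odot>\<^bsub>V\<^esub> e))" for x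
  have l_eq: "l (n \<oplus>\<^bsub>V\<^esub> c \<odot>\<^bsub>V\<^esub> e) = c" if "n \<in> N" "c \<in> carrier F" for n c
    unfolding l_def by (rule the_equality) (use that unique in blast)+
  have "linear_functional F V l"
    unfolding linear_functional_def
  proof (intro conjI ballI)
    fix x assume x: "x \<in> carrier V"
    then obtain c n where c: "c \<in> carrier F" "n \<in> N" "x = n \<oplus>\<^bsub>V\<^esub> c \<odot>\<^bsub>V\<^esub> e"
      using span by blast
    then show "l x \<in> carrier F" by (simp add: l_eq)
    fix y assume "y \<in> carrier V"
    then obtain d m where d: "d \<in> carrier F" "m \<in> N" "y = m \<oplus>\<^bsub>V\<^esub> d \<odot>\<^bsub>V\<^esub> e"
      using span by blast
    have "x \<oplus>\<^bsub>V\<^esub> y = (n \<oplus>\<^bsub>V\<^esub> m) \<oplus>\<^bsub>V\<^esub> (c \<oplus>\<^bsub>F\<^esub> d) \<odot>\<^bsub>V\<^esub> e"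
      using c d e NV by (simp add: V.smult_l_distr V.M.a_ac)
    then show "l (x \<oplus>\<^bsub>V\<^esub> y) = l x \<oplus>\<^bsub>F\<^esub> l y"
      using c d NE(5) by (simp add: l_eq)
  next
    fix a x assume a: "a \<in> carrier F" and "x \<in> carrier V"
    then obtain c n where c: "c \<in> carrier F" "n \<in> N" "x = n \<oplus>\<^bsub>V\<^esub> c \<odot>\<^bsub>V\<^esub> e"
      using span by blast
    have "a \<odot>\<^bsub>V\<^esub> x = a \<odot>\<^bsub>V\<^esub> n \<oplus>\<^bsub>V\<^esub> (a \<otimes>\<^bsub>F\<^esub> c) \<odot>\<^bsub>V\<^esub> e"
      using c a e NV by (simp add: V.smult_r_distr V.smult_assoc1)
    then show "l (a \<odot>\<^bsub>V\<^esub> x) = a \<otimes>\<^bsub>F\<^esub> l x"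
      using c a NE(4) by (simp add: l_eq)
  qed
  moreover have "l e = \<one>\<^bsub>F\<^esub>"
    using l_eq[OF N_zero, of "\<one>\<^bsub>F\<^esub>"] e by simp
  ultimately show ?thesis by blast
qed


section \<open>Vidinli algebras\<close>

locale vidinli_algebra_char_not_2 = vidinli_algebra F A q
  for F :: "('f, 'm) ring_scheme" (structure) and A :: "('f, 'a) module" (structure) and q +
  assumes char_not_2: "\<one>\<^bsub>F\<^esub> \<oplus>\<^bsub>F\<^esub> \<one>\<^bsub>F\<^esub> \<noteq> \<zero>\<^bsub>F\<^esub>"
begin

definition half where "half = inv\<^bsub>F\<^esub> (\<one>\<^bsub>F\<^esub> \<oplus>\<^bsub>F\<^esub> \<one>\<^bsub>F\<^esub>)"
abbreviation pol where "pol \<equiv> polar F A q"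
abbreviation V where "V \<equiv> trace_zero F A q"
abbreviation B where "B \<equiv> vidinli_form F A q"

text \<open>
  Half the trace, that is, the coefficient of the unity in the decomposition of the algebra, with \<open>pr\<close> the
  complementary projection onto \<open>V\<close>.
\<close>

definition tr where "tr x = half \<otimes>\<^bsub>F\<^esub> pol x \<one>\<^bsub>A\<^esub>"
definition pr where "pr x = x \<oplus>\<^bsub>A\<^esub> (\<ominus>\<^bsub>F\<^esub> tr x) \<odot>\<^bsub>A\<^esub> \<one>\<^bsub>A\<^esub>"

lemma half: "half \<in> carrier F" "half \<otimes>\<^bsub>F\<^esub> (\<one>\<^bsub>F\<^esub> \<oplus>\<^bsub>F\<^esub> \<one>\<^bsub>F\<^esub>) = \<one>\<^bsub>F\<^esub>"
  using char_not_2 F.field_Units unfolding half_def by auto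

lemma pol:
  shows pol_closed: "\<lbrakk>x \<in> carrier A; y \<in> carrier A\<rbrakk> \<Longrightarrow> pol x y \<in> carrier F"
    and pol_add: "\<lbrakk>x \<in> carrier A; y \<in> carrier A; z \<in> carrier A\<rbrakk> \<Longrightarrow>
      pol (x \<oplus>\<^bsub>A\<^esub> y) z = pol x z \<oplus>\<^bsub>F\<^esub> pol y z"
    and pol_smult: "\<lbrakk>c \<in> carrier F; x \<in> carrier A; y \<in> carrier A\<rbrakk> \<Longrightarrow>
      pol (c \<odot>\<^bsub>A\<^esub> x) y = c \<otimes>\<^bsub>F\<^esub> pol x y"
  using norm_quadratic by (auto simp: quadratic_form_def bilinear_form_def)

lemma q_closed: "x \<in> carrier A \<Longrightarrow> q x \<in> carrier F"
  using norm_quadratic by (simp add: quadratic_form_def)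

lemma tr_functional: "linear_functional F A tr"
  unfolding linear_functional_def tr_def
  by (simp add: pol unity_closed half R.r_distr R.m_lcomm)

lemmas trD = linear_functionalD[OF tr_functional]

text \<open>
  The polar form of \<open>q\<close> at the unity is \<open>q(1 + 1) - q(1) - q(1) = 4 - 2 = 2\<close>.
\<close>

lemma tr_one: "tr \<one>\<^bsub>A\<^esub> = \<one>\<^bsub>F\<^esub>"
proof -
  let ?two = "\<one>\<^bsub>F\<^esub> \<oplus>\<^bsub>F\<^esub> \<one>\<^bsub>F\<^esub>"
  have "\<one>\<^bsub>A\<^esub> \<oplus>\<^bsub>A\<^esub> \<one>\<^bsub>A\<^esub> = ?two \<odot>\<^bsub>A\<^esub> \<one>\<^bsub>A\<^esub>"
    using unity_closed by (simp add: smult_l_distr)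
  moreover have "q (?two \<odot>\<^bsub>A\<^esub> \<one>\<^bsub>A\<^esub>) = ?two \<otimes>\<^bsub>F\<^esub> ?two"
    using norm_quadratic unity_closed norm_unity by (simp add: quadratic_form_def)
  moreover have "?two \<otimes>\<^bsub>F\<^esub> ?two = ?two \<oplus>\<^bsub>F\<^esub> ?two"
    by (simp add: R.l_distr)
  ultimately have "pol \<one>\<^bsub>A\<^esub> \<one>\<^bsub>A\<^esub> = ?two \<oplus>\<^bsub>F\<^esub> ?two \<oplus>\<^bsub>F\<^esub> \<ominus>\<^bsub>F\<^esub> \<one>\<^bsub>F\<^esub> \<oplus>\<^bsub>F\<^esub> \<ominus>\<^bsub>F\<^esub> \<one>\<^bsub>F\<^esub>"
    by (simp add: polar_def norm_unity a_minus_def)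
  also have "\<dots> = ?two" by (simp add: R.a_ac R.r_neg R.r_neg2 R.r_neg1)
  finally show ?thesis using half by (simp add: tr_def)
qed

lemma trace_zero_simps [simp]:
  "ring.add V = ring.add A" "ring.zero V = ring.zero A" "smult V = smult A"
  by (simp_all add: trace_zero_def)

lemma carrier_V: "x \<in> carrier V \<longleftrightarrow> x \<in> carrier A \<and> tr x = \<zero>\<^bsub>F\<^esub>"
proof -
  have "half \<noteq> \<zero>\<^bsub>F\<^esub>" using half by (metis R.l_null R.add.m_closed R.one_closed F.zero_not_one)
  then show ?thesis
    using half F.integral[of half "pol x \<one>\<^bsub>A\<^esub>"] pol_closed[OF _ unity_closed, of x]
    by (auto simp: trace_zero_def tr_def)
qed

lemma V_A: "x \<in> carrier V \<Longrightarrow> x \<in> carrier A"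
  and tr_V: "x \<in> carrier V \<Longrightarrow> tr x = \<zero>\<^bsub>F\<^esub>"
  by (simp_all add: carrier_V)

lemma module_V: "module F V"
proof -
  have "submodule (carrier V) F A"
  proof (rule submoduleI)
    have "tr (\<zero>\<^bsub>F\<^esub> \<odot>\<^bsub>A\<^esub> \<one>\<^bsub>A\<^esub>) = \<zero>\<^bsub>F\<^esub> \<otimes>\<^bsub>F\<^esub> tr \<one>\<^bsub>A\<^esub>"
      by (rule trD) (simp_all add: unity_closed)
    then show "\<zero>\<^bsub>A\<^esub> \<in> carrier V" using unity_closed by (simp add: carrier_V tr_one)
    show "\<ominus>\<^bsub>A\<^esub> x \<in> carrier V" if "x \<in> carrier V" for x
    proof -
      have "\<ominus>\<^bsub>A\<^esub> x = (\<ominus>\<^bsub>F\<^esub> \<one>\<^bsub>F\<^esub>) \<odot>\<^bsub>A\<^esub> x"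
        using that by (simp add: V_A smult_l_minus)
      then show ?thesis using that by (simp add: carrier_V trD)
    qed
  qed (auto simp: carrier_V trD)
  then have "module F (A\<lparr>carrier := carrier V\<rparr>)"
    by (rule submodule.submodule_is_module) (rule module_axioms)
  then show ?thesis by (simp add: trace_zero_def)
qed

lemma pr_closed: "x \<in> carrier A \<Longrightarrow> pr x \<in> carrier V"
  unfolding carrier_V pr_def by (simp add: unity_closed trD tr_one R.r_neg)

lemma pr_linear: "linear_map F A V pr"
  unfolding linear_map_def
proof (intro conjI ballI)
  fix x y assume m: "x \<in> carrier A" "y \<in> carrier A"
  have "(\<ominus>\<^bsub>F\<^esub> (tr x \<oplus>\<^bsub>F\<^esub> tr y)) = (\<ominus>\<^bsub>F\<^esub> tr x) \<oplus>\<^bsub>F\<^esub> (\<ominus>\<^bsub>F\<^esub> tr y)"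
    using m by (simp add: trD R.minus_add)
  then show "pr (x \<oplus>\<^bsub>A\<^esub> y) = pr x \<oplus>\<^bsub>V\<^esub> pr y"
    using m by (simp add: pr_def trD unity_closed smult_l_distr M.a_ac)
next
  fix c x assume m: "c \<in> carrier F" "x \<in> carrier A"
  have "\<ominus>\<^bsub>F\<^esub> (c \<otimes>\<^bsub>F\<^esub> tr x) = c \<otimes>\<^bsub>F\<^esub> (\<ominus>\<^bsub>F\<^esub> tr x)"
    using m by (simp add: trD R.r_minus)
  then show "pr (c \<odot>\<^bsub>A\<^esub> x) = c \<odot>\<^bsub>V\<^esub> pr x"
    using m by (simp add: pr_def trD unity_closed smult_r_distr smult_assoc1)
qed (simp add: pr_closed)

lemmas prD = linear_mapD[OF pr_linear, simplified trace_zero_simps]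

lemma pr_V: "x \<in> carrier V \<Longrightarrow> pr x = x"
  by (simp add: pr_def tr_V V_A unity_closed)

lemma pr_one: "pr \<one>\<^bsub>A\<^esub> = \<zero>\<^bsub>A\<^esub>"
  by (simp add: pr_def tr_one unity_closed smult_l_minus M.r_neg)

lemma scalar_plus_pr: "x \<in> carrier A \<Longrightarrow> x = tr x \<odot>\<^bsub>A\<^esub> \<one>\<^bsub>A\<^esub> \<oplus>\<^bsub>A\<^esub> pr x"
  by (simp add: pr_def unity_closed trD smult_l_minus M.a_lcomm M.r_neg)

lemma omega:
  assumes x: "x \<in> carrier A" and y: "y \<in> carrier A"
  shows "vidinli_omega F A x y \<in> carrier F"
    and "commutator A x y = vidinli_omega F A x y \<odot>\<^bsub>A\<^esub> \<one>\<^bsub>A\<^esub>"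
proof -
  have "\<exists>!c. c \<in> carrier F \<and> commutator A x y = c \<odot>\<^bsub>A\<^esub> \<one>\<^bsub>A\<^esub>"
  proof -
    have "c = d" if "c \<in> carrier F" "d \<in> carrier F" "c \<odot>\<^bsub>A\<^esub> \<one>\<^bsub>A\<^esub> = d \<odot>\<^bsub>A\<^esub> \<one>\<^bsub>A\<^esub>" for c d
      using arg_cong[OF that(3), of tr] that(1,2) by (simp add: trD unity_closed tr_one)
    then show ?thesis using commutator_scalar[OF x y] by metis
  qed
  from theI'[OF this]
  show "vidinli_omega F A x y \<in> carrier F"
    and "commutator A x y = vidinli_omega F A x y \<odot>\<^bsub>A\<^esub> \<one>\<^bsub>A\<^esub>"
    by (simp_all add: vidinli_omega_def)
qed

lemma B_closed: "\<lbrakk>x \<in> carrier A; y \<in> carrier A\<rbrakk> \<Longrightarrow> B x y \<in> carrier F"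
  using half by (simp add: vidinli_form_def half_def omega pol_closed)

lemma square_V:
  assumes x: "x \<in> carrier V"
  shows "x \<otimes>\<^bsub>A\<^esub> x = (\<ominus>\<^bsub>F\<^esub> q x) \<odot>\<^bsub>A\<^esub> \<one>\<^bsub>A\<^esub>"
proof -
  have xA: "x \<in> carrier A" using x by (rule V_A)
  have "pol x \<one>\<^bsub>A\<^esub> = \<zero>\<^bsub>F\<^esub>" using x by (simp add: trace_zero_def)
  then have "x \<otimes>\<^bsub>A\<^esub> x \<oplus>\<^bsub>A\<^esub> q x \<odot>\<^bsub>A\<^esub> \<one>\<^bsub>A\<^esub> = \<zero>\<^bsub>A\<^esub>"
    using conic_identity[OF xA] xA M.minus_equality[of "\<zero>\<^bsub>A\<^esub>" "\<zero>\<^bsub>A\<^esub>"]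
    by (simp add: a_minus_def amult_closed)
  then have "\<ominus>\<^bsub>A\<^esub> (q x \<odot>\<^bsub>A\<^esub> \<one>\<^bsub>A\<^esub>) = x \<otimes>\<^bsub>A\<^esub> x"
    using xA by (intro M.minus_equality) (simp_all add: amult_closed q_closed unity_closed)
  then show ?thesis using xA by (simp add: smult_l_minus q_closed unity_closed)
qed

text \<open>
  Linearising the conic identity on \<open>V\<close> gives \<open>x y + y x = - q(x, y) 1\<close>, while \<open>x y - y x = \<omega>(x, y) 1\<close>.
  Adding the two and halving gives the product.
\<close>

lemma mult_V:
  assumes x: "x \<in> carrier V" and y: "y \<in> carrier V"
  shows "x \<otimes>\<^bsub>A\<^esub> y = (\<ominus>\<^bsub>F\<^esub> B x y) \<odot>\<^bsub>A\<^esub> \<one>\<^bsub>A\<^esub>"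
proof -
  interpret V: module F V by (rule module_V)
  let ?e = "\<lambda>c. c \<odot>\<^bsub>A\<^esub> \<one>\<^bsub>A\<^esub>"
  let ?w = "vidinli_omega F A x y"
  have c: "x \<in> carrier A" "y \<in> carrier A" "x \<oplus>\<^bsub>A\<^esub> y \<in> carrier A" "x \<oplus>\<^bsub>A\<^esub> y \<in> carrier V"
    using x y V.M.a_closed[OF x y] by (simp_all add: V_A)
  note cs = c(1-3) amult_closed q_closed unity_closed pol_closed omega(1)
  define s where "s = x \<otimes>\<^bsub>A\<^esub> y \<oplus>\<^bsub>A\<^esub> y \<otimes>\<^bsub>A\<^esub> x"
  have sA: "s \<in> carrier A" by (simp add: s_def cs)
  have "?e (\<ominus>\<^bsub>F\<^esub> q (x \<oplus>\<^bsub>A\<^esub> y)) = (x \<oplus>\<^bsub>A\<^esub> y) \<otimes>\<^bsub>A\<^esub> (x \<oplus>\<^bsub>A\<^esub> y)"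
    using square_V[OF c(4)] by simp
  also have "\<dots> = x \<otimes>\<^bsub>A\<^esub> x \<oplus>\<^bsub>A\<^esub> y \<otimes>\<^bsub>A\<^esub> y \<oplus>\<^bsub>A\<^esub> s"
    by (simp add: amult_l_distr amult_r_distr cs s_def M.a_ac)
  also have "\<dots> = ?e (\<ominus>\<^bsub>F\<^esub> q x \<oplus>\<^bsub>F\<^esub> \<ominus>\<^bsub>F\<^esub> q y) \<oplus>\<^bsub>A\<^esub> s"
    using square_V[OF x] square_V[OF y] by (simp add: smult_l_distr cs)
  finally have eq: "?e (\<ominus>\<^bsub>F\<^esub> q (x \<oplus>\<^bsub>A\<^esub> y)) = ?e (\<ominus>\<^bsub>F\<^esub> q x \<oplus>\<^bsub>F\<^esub> \<ominus>\<^bsub>F\<^esub> q y) \<oplus>\<^bsub>A\<^esub> s" .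
  have "s = ?e (q x \<oplus>\<^bsub>F\<^esub> q y) \<oplus>\<^bsub>A\<^esub> (?e (\<ominus>\<^bsub>F\<^esub> q x \<oplus>\<^bsub>F\<^esub> \<ominus>\<^bsub>F\<^esub> q y) \<oplus>\<^bsub>A\<^esub> s)"
  proof -
    have "?e (q x \<oplus>\<^bsub>F\<^esub> q y) \<oplus>\<^bsub>A\<^esub> ?e (\<ominus>\<^bsub>F\<^esub> q x \<oplus>\<^bsub>F\<^esub> \<ominus>\<^bsub>F\<^esub> q y) = \<zero>\<^bsub>A\<^esub>"
      by (simp add: cs R.r_neg R.minus_add[symmetric] smult_l_minus M.r_neg)
    then show ?thesis
      using sA by (simp add: cs M.a_assoc[symmetric])
  qed
  also have "\<dots> = ?e ((q x \<oplus>\<^bsub>F\<^esub> q y) \<oplus>\<^bsub>F\<^esub> \<ominus>\<^bsub>F\<^esub> q (x \<oplus>\<^bsub>A\<^esub> y))"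
    unfolding eq[symmetric] by (simp add: cs smult_l_distr)
  also have "(q x \<oplus>\<^bsub>F\<^esub> q y) \<oplus>\<^bsub>F\<^esub> \<ominus>\<^bsub>F\<^esub> q (x \<oplus>\<^bsub>A\<^esub> y) = \<ominus>\<^bsub>F\<^esub> pol x y"
    by (simp add: polar_def a_minus_def cs R.minus_add R.a_ac)
  finally have s: "s = ?e (\<ominus>\<^bsub>F\<^esub> pol x y)" .
  have w: "x \<otimes>\<^bsub>A\<^esub> y \<oplus>\<^bsub>A\<^esub> \<ominus>\<^bsub>A\<^esub> (y \<otimes>\<^bsub>A\<^esub> x) = ?e ?w"
    using omega(2)[OF c(1,2)] by (simp add: commutator_def a_minus_def)
  let ?two = "\<one>\<^bsub>F\<^esub> \<oplus>\<^bsub>F\<^esub> \<one>\<^bsub>F\<^esub>"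
  have "?two \<odot>\<^bsub>A\<^esub> (x \<otimes>\<^bsub>A\<^esub> y) = s \<oplus>\<^bsub>A\<^esub> (x \<otimes>\<^bsub>A\<^esub> y \<oplus>\<^bsub>A\<^esub> \<ominus>\<^bsub>A\<^esub> (y \<otimes>\<^bsub>A\<^esub> x))"
  proof -
    have "s \<oplus>\<^bsub>A\<^esub> (x \<otimes>\<^bsub>A\<^esub> y \<oplus>\<^bsub>A\<^esub> \<ominus>\<^bsub>A\<^esub> (y \<otimes>\<^bsub>A\<^esub> x)) =
      (x \<otimes>\<^bsub>A\<^esub> y \<oplus>\<^bsub>A\<^esub> x \<otimes>\<^bsub>A\<^esub> y) \<oplus>\<^bsub>A\<^esub> (y \<otimes>\<^bsub>A\<^esub> x \<oplus>\<^bsub>A\<^esub> \<ominus>\<^bsub>A\<^esub> (y \<otimes>\<^bsub>A\<^esub> x))"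
      by (simp add: s_def cs M.a_ac)
    then show ?thesis by (simp add: cs M.r_neg smult_l_distr)
  qed
  also have "\<dots> = ?e (\<ominus>\<^bsub>F\<^esub> (pol x y \<ominus>\<^bsub>F\<^esub> ?w))"
    unfolding s w by (simp add: cs smult_l_distr[symmetric] a_minus_def R.minus_add)
  finally have "half \<odot>\<^bsub>A\<^esub> (?two \<odot>\<^bsub>A\<^esub> (x \<otimes>\<^bsub>A\<^esub> y)) = half \<odot>\<^bsub>A\<^esub> ?e (\<ominus>\<^bsub>F\<^esub> (pol x y \<ominus>\<^bsub>F\<^esub> ?w))"
    by simp
  moreover have "half \<odot>\<^bsub>A\<^esub> (?two \<odot>\<^bsub>A\<^esub> (x \<otimes>\<^bsub>A\<^esub> y)) = x \<otimes>\<^bsub>A\<^esub> y"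
    using smult_assoc1[of half ?two "x \<otimes>\<^bsub>A\<^esub> y"] half by (simp add: cs)
  moreover have "half \<odot>\<^bsub>A\<^esub> ?e (\<ominus>\<^bsub>F\<^esub> (pol x y \<ominus>\<^bsub>F\<^esub> ?w)) = ?e (\<ominus>\<^bsub>F\<^esub> B x y)"
    using half(1) by (simp add: cs smult_assoc1[symmetric] vidinli_form_def R.r_minus flip: half_def)
  ultimately show ?thesis by simp
qed

lemma mult_decomposed:
  assumes x: "x \<in> carrier A" and y: "y \<in> carrier A"
  shows "x \<otimes>\<^bsub>A\<^esub> y = (tr x \<otimes>\<^bsub>F\<^esub> tr y \<oplus>\<^bsub>F\<^esub> \<ominus>\<^bsub>F\<^esub> B (pr x) (pr y)) \<odot>\<^bsub>A\<^esub> \<one>\<^bsub>A\<^esub> \<oplus>\<^bsub>A\<^esub>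
    (tr x \<odot>\<^bsub>A\<^esub> pr y \<oplus>\<^bsub>A\<^esub> tr y \<odot>\<^bsub>A\<^esub> pr x)"
proof -
  have p: "pr x \<in> carrier A" "pr y \<in> carrier A" "pr x \<in> carrier V" "pr y \<in> carrier V"
    using x y by (simp_all add: pr_closed V_A)
  have t: "tr x \<in> carrier F" "tr y \<in> carrier F" using x y by (simp_all add: trD)
  have "x \<otimes>\<^bsub>A\<^esub> y = (tr x \<odot>\<^bsub>A\<^esub> \<one>\<^bsub>A\<^esub> \<oplus>\<^bsub>A\<^esub> pr x) \<otimes>\<^bsub>A\<^esub> (tr y \<odot>\<^bsub>A\<^esub> \<one>\<^bsub>A\<^esub> \<oplus>\<^bsub>A\<^esub> pr y)"
    using scalar_plus_pr[OF x] scalar_plus_pr[OF y] by argo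
  also have "\<dots> = (tr x \<otimes>\<^bsub>F\<^esub> tr y) \<odot>\<^bsub>A\<^esub> \<one>\<^bsub>A\<^esub> \<oplus>\<^bsub>A\<^esub> tr y \<odot>\<^bsub>A\<^esub> pr x \<oplus>\<^bsub>A\<^esub> (tr x \<odot>\<^bsub>A\<^esub> pr y \<oplus>\<^bsub>A\<^esub> pr x \<otimes>\<^bsub>A\<^esub> pr y)"
    using p t
    by (simp add: amult_l_distr amult_r_distr amult_smult_l amult_smult_r amult_closed
        unity_closed unity_l unity_r smult_r_distr M.a_ac
        smult_assoc1[symmetric] R.m_comm)
  also have "\<dots> = (tr x \<otimes>\<^bsub>F\<^esub> tr y \<oplus>\<^bsub>F\<^esub> \<ominus>\<^bsub>F\<^esub> B (pr x) (pr y)) \<odot>\<^bsub>A\<^esub> \<one>\<^bsub>A\<^esub> \<oplus>\<^bsub>A\<^esub>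
    (tr x \<odot>\<^bsub>A\<^esub> pr y \<oplus>\<^bsub>A\<^esub> tr y \<odot>\<^bsub>A\<^esub> pr x)"
    using p t
    by (simp add: mult_V unity_closed smult_l_distr B_closed V_A M.a_ac)
  finally show ?thesis .
qed

lemma tr_mult: "\<lbrakk>x \<in> carrier A; y \<in> carrier A\<rbrakk> \<Longrightarrow>
    tr (x \<otimes>\<^bsub>A\<^esub> y) = tr x \<otimes>\<^bsub>F\<^esub> tr y \<ominus>\<^bsub>F\<^esub> B (pr x) (pr y)"
  by (subst mult_decomposed)
    (simp_all add: trD tr_one tr_V B_closed pr_closed V_A unity_closed a_minus_def)

lemma pr_mult: "\<lbrakk>x \<in> carrier A; y \<in> carrier A\<rbrakk> \<Longrightarrow>
    pr (x \<otimes>\<^bsub>A\<^esub> y) = tr x \<odot>\<^bsub>A\<^esub> pr y \<oplus>\<^bsub>A\<^esub> tr y \<odot>\<^bsub>A\<^esub> pr x"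
  by (subst mult_decomposed)
    (simp_all add: trD prD pr_one pr_V B_closed pr_closed V_A unity_closed)

text \<open>
  By the product formula on \<open>V\<close> the form is \<open>B(x, y) = - tr(x y)\<close>, which is visibly bilinear; this
  bypasses the definite description behind \<open>\<omega>\<close>.
\<close>

lemma form_V: "bilinear_form F V B"
proof -
  have B: "B x y = \<ominus>\<^bsub>F\<^esub> tr (x \<otimes>\<^bsub>A\<^esub> y)" if "x \<in> carrier V" "y \<in> carrier V" for x y
    using that by (simp add: mult_V trD tr_one unity_closed B_closed V_A)
  interpret V: module F V by (rule module_V)
  note Vc = V.M.a_closed[simplified] V.smult_closed[simplified]
  show ?thesis
    unfolding bilinear_form_def
    by (simp add: B Vc V_A amult_closed amult_l_distr amult_r_distr amult_smult_l amult_smult_r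
        trD R.minus_add R.r_minus)
qed

end


section \<open>Change of scalars along a homomorphism\<close>

locale scalar_extension_hom =
  R: scalar_extension F M R + S: scalar_extension F M S
  for F (structure) and M (structure) and R (structure) and S (structure) +
  fixes \<phi>
  assumes hom: "\<phi> \<in> algebra_hom F R S"
begin

abbreviation scalar_map where "scalar_map \<equiv> tensor_scalar_map F M R S \<phi>"

lemma \<phi>_rules:
  shows \<phi>_closed: "r \<in> carrier R \<Longrightarrow> \<phi> r \<in> carrier S"
    and \<phi>_add: "\<lbrakk>r \<in> carrier R; r' \<in> carrier R\<rbrakk> \<Longrightarrow> \<phi> (r \<oplus>\<^bsub>R\<^esub> r') = \<phi> r \<oplus>\<^bsub>S\<^esub> \<phi> r'"
    and \<phi>_mult: "\<lbrakk>r \<in> carrier R; r' \<in> carrier R\<rbrakk> \<Longrightarrow> \<phi> (r \<otimes>\<^bsub>R\<^esub> r') = \<phi> r \<otimes>\<^bsub>S\<^esub> \<phi> r'"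
    and \<phi>_one: "\<phi> \<one>\<^bsub>R\<^esub> = \<one>\<^bsub>S\<^esub>"
    and \<phi>_smult: "\<lbrakk>c \<in> carrier F; r \<in> carrier R\<rbrakk> \<Longrightarrow> \<phi> (c \<odot>\<^bsub>R\<^esub> r) = c \<odot>\<^bsub>S\<^esub> \<phi> r"
  using hom by (auto simp: algebra_hom_def ring_hom_def)

lemma balanced_scalar_map: "R.balanced (tensor_group F M S) (\<lambda>x r. S.pure x (\<phi> r))"
  by (rule R.balancedI)
    (simp_all add: \<phi>_rules S.pure_add_left S.pure_add_right S.pure_smult)

lemma scalar_map_closed: "u \<in> carrier R.MR \<Longrightarrow> scalar_map u \<in> carrier S.MR"
  and scalar_map_add: "\<lbrakk>u \<in> carrier R.MR; v \<in> carrier R.MR\<rbrakk> \<Longrightarrow>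
    scalar_map (u \<oplus>\<^bsub>R.MR\<^esub> v) = scalar_map u \<oplus>\<^bsub>S.MR\<^esub> scalar_map v"
  and scalar_map_pure: "\<lbrakk>x \<in> carrier M; r \<in> carrier R\<rbrakk> \<Longrightarrow>
    scalar_map (R.pure x r) = S.pure x (\<phi> r)"
  using R.lift_closed[OF S.comm_group_tensor balanced_scalar_map]
    R.lift_add[OF S.comm_group_tensor balanced_scalar_map]
    R.lift_pure[OF S.comm_group_tensor balanced_scalar_map]
  by (simp_all add: tensor_scalar_map_def)

lemma scalar_map_smult:
  assumes r: "r \<in> carrier R" and u: "u \<in> carrier R.MR"
  shows "scalar_map (r \<odot>\<^bsub>R.MR\<^esub> u) = \<phi> r \<odot>\<^bsub>S.MR\<^esub> scalar_map u"
  using u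
  by (induction rule: R.tensor_induct)
    (use r in \<open>simp_all add: scalar_map_pure \<phi>_rules scalar_map_add scalar_map_closed
      R.smult_MR_add R.smult_MR_closed S.smult_MR_add\<close>)

context
  fixes g
  assumes g: "linear_map R R.MR R.MR g"
begin

text \<open>
  Balancedness holds because \<open>g\<close> is linear over \<open>R\<close> and \<open>id \<otimes> \<phi>\<close> is linear along \<open>\<phi>\<close>: a scalar \<open>c\<close> of the
  base field can be moved to \<open>c 1\<close> in \<open>R\<close>, through \<open>g\<close>, and then to \<open>c 1\<close> in \<open>S\<close>.
\<close>

lemma balanced_transition:
  "S.balanced (tensor_group F M S) (\<lambda>x s. s \<odot>\<^bsub>S.MR\<^esub> scalar_map (g (R.pure x \<one>\<^bsub>R\<^esub>)))"
proof (rule S.balancedI)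
  interpret SM: module S S.MR by (rule S.module_MR)
  note gD = linear_mapD[OF g]
  fix c x s
  assume c: "c \<in> carrier F" and x: "x \<in> carrier M" and s: "s \<in> carrier S"
  have "R.pure (c \<odot>\<^bsub>M\<^esub> x) \<one>\<^bsub>R\<^esub> = (c \<odot>\<^bsub>R\<^esub> \<one>\<^bsub>R\<^esub>) \<odot>\<^bsub>R.MR\<^esub> R.pure x \<one>\<^bsub>R\<^esub>"
    using c x by (simp add: R.pure_smult)
  then have "g (R.pure (c \<odot>\<^bsub>M\<^esub> x) \<one>\<^bsub>R\<^esub>) = (c \<odot>\<^bsub>R\<^esub> \<one>\<^bsub>R\<^esub>) \<odot>\<^bsub>R.MR\<^esub> g (R.pure x \<one>\<^bsub>R\<^esub>)"
    using c x by (simp only: gD R.pure_closed R.R.smult_closed R.R.one_closed)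
  then have "scalar_map (g (R.pure (c \<odot>\<^bsub>M\<^esub> x) \<one>\<^bsub>R\<^esub>)) =
      (c \<odot>\<^bsub>S\<^esub> \<one>\<^bsub>S\<^esub>) \<odot>\<^bsub>S.MR\<^esub> scalar_map (g (R.pure x \<one>\<^bsub>R\<^esub>))"
    using c x by (simp add: gD scalar_map_smult \<phi>_rules)
  moreover have "s \<otimes>\<^bsub>S\<^esub> (c \<odot>\<^bsub>S\<^esub> \<one>\<^bsub>S\<^esub>) = c \<odot>\<^bsub>S\<^esub> s"
    using c s by (simp add: S.R_smult_mult)
  ultimately show "s \<odot>\<^bsub>S.MR\<^esub> scalar_map (g (R.pure (c \<odot>\<^bsub>M\<^esub> x) \<one>\<^bsub>R\<^esub>)) =
      (c \<odot>\<^bsub>S\<^esub> s) \<odot>\<^bsub>S.MR\<^esub> scalar_map (g (R.pure x \<one>\<^bsub>R\<^esub>))"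
    using c x s by (simp add: gD scalar_map_closed flip: SM.smult_assoc1)
next
  interpret SM: module S S.MR by (rule S.module_MR)
  note gD = linear_mapD[OF g]
  show "s \<odot>\<^bsub>S.MR\<^esub> scalar_map (g (R.pure x \<one>\<^bsub>R\<^esub>)) \<in> carrier (tensor_group F M S)"
    if "x \<in> carrier M" "s \<in> carrier S" for x s
    using that by (simp add: gD scalar_map_closed)
  show "s \<odot>\<^bsub>S.MR\<^esub> scalar_map (g (R.pure (x \<oplus>\<^bsub>M\<^esub> y) \<one>\<^bsub>R\<^esub>)) =
      (s \<odot>\<^bsub>S.MR\<^esub> scalar_map (g (R.pure x \<one>\<^bsub>R\<^esub>))) \<otimes>\<^bsub>tensor_group F M S\<^esub>
      (s \<odot>\<^bsub>S.MR\<^esub> scalar_map (g (R.pure y \<one>\<^bsub>R\<^esub>)))"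
    if "x \<in> carrier M" "y \<in> carrier M" "s \<in> carrier S" for x y s
    using that by (simp add: R.pure_add_left gD scalar_map_add scalar_map_closed SM.smult_r_distr)
  show "(s \<oplus>\<^bsub>S\<^esub> s') \<odot>\<^bsub>S.MR\<^esub> scalar_map (g (R.pure x \<one>\<^bsub>R\<^esub>)) =
      (s \<odot>\<^bsub>S.MR\<^esub> scalar_map (g (R.pure x \<one>\<^bsub>R\<^esub>))) \<otimes>\<^bsub>tensor_group F M S\<^esub>
      (s' \<odot>\<^bsub>S.MR\<^esub> scalar_map (g (R.pure x \<one>\<^bsub>R\<^esub>)))"
    if "x \<in> carrier M" "s \<in> carrier S" "s' \<in> carrier S" for x s s'
    using that by (simp add: gD scalar_map_closed SM.smult_l_distr)
qed

lemma transition_closed: "u \<in> carrier S.MR \<Longrightarrow> transition_map F M R S \<phi> g u \<in> carrier S.MR"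
  and transition_add: "\<lbrakk>u \<in> carrier S.MR; v \<in> carrier S.MR\<rbrakk> \<Longrightarrow>
    transition_map F M R S \<phi> g (u \<oplus>\<^bsub>S.MR\<^esub> v) =
    transition_map F M R S \<phi> g u \<oplus>\<^bsub>S.MR\<^esub> transition_map F M R S \<phi> g v"
  and transition_pure: "\<lbrakk>x \<in> carrier M; s \<in> carrier S\<rbrakk> \<Longrightarrow>
    transition_map F M R S \<phi> g (S.pure x s) =
    s \<odot>\<^bsub>S.MR\<^esub> scalar_map (g (R.pure x \<one>\<^bsub>R\<^esub>))"
  and transition_extensional: "transition_map F M R S \<phi> g \<in> extensional (carrier S.MR)"
  using S.lift_closed[OF S.comm_group_tensor balanced_transition]
    S.lift_add[OF S.comm_group_tensor balanced_transition]
    S.lift_pure[OF S.comm_group_tensor balanced_transition]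
    S.lift_extensional[OF S.comm_group_tensor balanced_transition]
  by (simp_all add: transition_map_def)

end

end


section \<open>Scalar extensions of a Vidinli algebra\<close>

locale vidinli_extension = vidinli_algebra_char_not_2 F A q + K: algebra F R
  for F :: "('f, 'm) ring_scheme" (structure) and A :: "('f, 'a) module" (structure) and q
    and R :: "('f, 'r, 'k) module_scheme" (structure)
begin

sublocale A: scalar_extension F A R
  by (intro scalar_extension.intro module_axioms K.algebra_axioms)

sublocale V: scalar_extension F V R
  by (intro scalar_extension.intro module_V K.algebra_axioms)

abbreviation AR where "AR \<equiv> base_change F A R"
abbreviation VR where "VR \<equiv> base_change F V R"
abbreviation incl where "incl \<equiv> tensor_inclusion F V A R"
abbreviation BR where "BR \<equiv> extend_form F V B R"

definition trR where "trR = tensor_lift F A R (add_monoid R) (\<lambda>x r. tr x \<odot>\<^bsub>R\<^esub> r)"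
definition prR where "prR = tensor_lift F A R (tensor_group F V R) (\<lambda>x r. V.pure (pr x) r)"

lemma balanced_tr: "A.balanced (add_monoid R) (\<lambda>x r. tr x \<odot>\<^bsub>R\<^esub> r)"
  by (rule A.balancedI)
    (simp_all add: trD K.smult_l_distr K.smult_r_distr R.m_comm flip: K.smult_assoc1)

lemma trR_functional: "linear_functional R AR trR"
  unfolding trR_def
  by (rule A.lift_linear_functional[OF balanced_tr]) (simp add: trD A.R_smult_mult)

lemma trR_pure: "\<lbrakk>x \<in> carrier A; r \<in> carrier R\<rbrakk> \<Longrightarrow> trR (A.pure x r) = tr x \<odot>\<^bsub>R\<^esub> r"
  unfolding trR_def by (rule A.lift_pure[OF A.comm_group_add_R balanced_tr])

lemma balanced_pr: "A.balanced (tensor_group F V R) (\<lambda>x r. V.pure (pr x) r)"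
  using V.pure_add_left V.pure_smult
  by (intro A.balancedI) (simp_all add: prD V.pure_add_right)

lemma prR_linear: "linear_map R AR VR prR"
  unfolding prR_def
  by (rule A.lift_linear_map[OF V.module_MR V.comm_group_tensor _ _ balanced_pr])
    (simp_all add: prD)

lemma prR_pure: "\<lbrakk>x \<in> carrier A; r \<in> carrier R\<rbrakk> \<Longrightarrow> prR (A.pure x r) = V.pure (pr x) r"
  unfolding prR_def by (rule A.lift_pure[OF V.comm_group_tensor balanced_pr])

lemma balanced_incl: "V.balanced (tensor_group F A R) A.pure"
  by (intro V.balancedI) (simp_all add: V_A A.pure_add_left A.pure_add_right A.pure_smult)

lemma incl_linear: "linear_map R VR AR incl"
  unfolding tensor_inclusion_def
  by (rule V.lift_linear_map[OF A.module_MR A.comm_group_tensor _ _ balanced_incl])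
    (simp_all add: V_A)

lemma incl_pure: "\<lbrakk>x \<in> carrier V; r \<in> carrier R\<rbrakk> \<Longrightarrow> incl (V.pure x r) = A.pure x r"
  unfolding tensor_inclusion_def by (rule V.lift_pure[OF A.comm_group_tensor balanced_incl])

lemmas trRD = linear_functionalD[OF trR_functional]
lemmas prRD = linear_mapD[OF prR_linear]
lemmas inclD = linear_mapD[OF incl_linear]

lemma one_AR: "\<one>\<^bsub>AR\<^esub> = A.pure \<one>\<^bsub>A\<^esub> \<one>\<^bsub>R\<^esub>"
  by (simp add: base_change_def del: tensor_group_base_change)

lemma trR_incl: "v \<in> carrier VR \<Longrightarrow> trR (incl v) = \<zero>\<^bsub>R\<^esub>"
  by (induction rule: V.tensor_induct)
    (simp_all add: incl_pure trR_pure V_A tr_V inclD trRD)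

lemma prR_incl: "v \<in> carrier VR \<Longrightarrow> prR (incl v) = v"
  by (induction rule: V.tensor_induct)
    (simp_all add: incl_pure prR_pure V_A pr_V inclD prRD)

lemma AR_decomposition: "u \<in> carrier AR \<Longrightarrow> trR u \<odot>\<^bsub>AR\<^esub> \<one>\<^bsub>AR\<^esub> \<oplus>\<^bsub>AR\<^esub> incl (prR u) = u"
proof (induction rule: A.tensor_induct)
  case (pure x r)
  have "trR (A.pure x r) \<odot>\<^bsub>AR\<^esub> \<one>\<^bsub>AR\<^esub> = A.pure (tr x \<odot>\<^bsub>A\<^esub> \<one>\<^bsub>A\<^esub>) r"
    using pure by (simp add: trR_pure one_AR unity_closed trD A.pure_smult)
  moreover have "incl (prR (A.pure x r)) = A.pure (pr x) r"
    using pure by (simp add: prR_pure incl_pure pr_closed)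
  ultimately have "trR (A.pure x r) \<odot>\<^bsub>AR\<^esub> \<one>\<^bsub>AR\<^esub> \<oplus>\<^bsub>AR\<^esub> incl (prR (A.pure x r)) =
      A.pure (tr x \<odot>\<^bsub>A\<^esub> \<one>\<^bsub>A\<^esub> \<oplus>\<^bsub>A\<^esub> pr x) r"
    using pure by (simp add: A.pure_add_left unity_closed trD pr_closed V_A)
  also have "tr x \<odot>\<^bsub>A\<^esub> \<one>\<^bsub>A\<^esub> \<oplus>\<^bsub>A\<^esub> pr x = x" by (rule scalar_plus_pr[symmetric]) (rule pure)
  finally show ?case .
next
  interpret E: module R AR by (rule A.module_MR)
  case (add v w)
  have c: "\<one>\<^bsub>AR\<^esub> \<in> carrier AR" by (simp add: one_AR unity_closed)
  have "trR (v \<oplus>\<^bsub>AR\<^esub> w) \<odot>\<^bsub>AR\<^esub> \<one>\<^bsub>AR\<^esub> \<oplus>\<^bsub>AR\<^esub> incl (prR (v \<oplus>\<^bsub>AR\<^esub> w)) =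
    (trR v \<odot>\<^bsub>AR\<^esub> \<one>\<^bsub>AR\<^esub> \<oplus>\<^bsub>AR\<^esub> incl (prR v)) \<oplus>\<^bsub>AR\<^esub> (trR w \<odot>\<^bsub>AR\<^esub> \<one>\<^bsub>AR\<^esub> \<oplus>\<^bsub>AR\<^esub> incl (prR w))"
    using add.hyps c by (simp add: trRD prRD inclD E.smult_l_distr A.MR.a_ac)
  then show ?case by (simp only: add.IH)
qed

context
begin

private abbreviation (input) mf where "mf x r y s \<equiv> A.pure (x \<otimes>\<^bsub>A\<^esub> y) (r \<otimes>\<^bsub>R\<^esub> s)"

private lemma mult_balanced_left:
  "\<lbrakk>y \<in> carrier A; s \<in> carrier R\<rbrakk> \<Longrightarrow> A.balanced (tensor_group F A R) (\<lambda>x r. mf x r y s)"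
  by (rule A.balancedI)
    (simp_all add: amult_closed amult_l_distr amult_smult_l A.pure_add_left A.pure_add_right
      K.l_distr A.pure_smult K.smult_assoc2)

private lemma mult_balanced_right:
  "\<lbrakk>x \<in> carrier A; r \<in> carrier R\<rbrakk> \<Longrightarrow> A.balanced (tensor_group F A R) (mf x r)"
  by (rule A.balancedI)
    (simp_all add: amult_closed amult_r_distr amult_smult_r A.pure_add_left A.pure_add_right
      K.r_distr A.pure_smult A.R_smult_mult)

private lemma mult_AR: "u \<otimes>\<^bsub>AR\<^esub> v =
    tensor_lift F A R (tensor_group F A R) (\<lambda>x r. tensor_lift F A R (tensor_group F A R) (mf x r) v) u"
  by (simp add: base_change_def del: tensor_group_base_change)

lemma mult_AR_closed: "\<lbrakk>u \<in> carrier AR; v \<in> carrier AR\<rbrakk> \<Longrightarrow> u \<otimes>\<^bsub>AR\<^esub> v \<in> carrier AR"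
  and mult_AR_add_left: "\<lbrakk>u \<in> carrier AR; u' \<in> carrier AR; v \<in> carrier AR\<rbrakk> \<Longrightarrow>
    (u \<oplus>\<^bsub>AR\<^esub> u') \<otimes>\<^bsub>AR\<^esub> v = u \<otimes>\<^bsub>AR\<^esub> v \<oplus>\<^bsub>AR\<^esub> u' \<otimes>\<^bsub>AR\<^esub> v"
  and mult_AR_add_right: "\<lbrakk>u \<in> carrier AR; v \<in> carrier AR; v' \<in> carrier AR\<rbrakk> \<Longrightarrow>
    u \<otimes>\<^bsub>AR\<^esub> (v \<oplus>\<^bsub>AR\<^esub> v') = u \<otimes>\<^bsub>AR\<^esub> v \<oplus>\<^bsub>AR\<^esub> u \<otimes>\<^bsub>AR\<^esub> v'"
  and mult_AR_pure: "\<lbrakk>x \<in> carrier A; r \<in> carrier R; y \<in> carrier A; s \<in> carrier R\<rbrakk> \<Longrightarrow>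
    A.pure x r \<otimes>\<^bsub>AR\<^esub> A.pure y s = A.pure (x \<otimes>\<^bsub>A\<^esub> y) (r \<otimes>\<^bsub>R\<^esub> s)"
  using A.bilift_closed[where f=mf, OF A.comm_group_tensor mult_balanced_left mult_balanced_right]
    A.bilift_add_left[where f=mf, OF A.comm_group_tensor mult_balanced_left mult_balanced_right]
    A.bilift_add_right[where f=mf, OF A.comm_group_tensor mult_balanced_left mult_balanced_right]
    A.bilift_pure[where f=mf, OF A.comm_group_tensor mult_balanced_left mult_balanced_right]
  by (simp_all add: mult_AR)

end

context
begin

private abbreviation (input) bf where "bf x r y s \<equiv> B x y \<odot>\<^bsub>R\<^esub> (r \<otimes>\<^bsub>R\<^esub> s)"

private lemma B:
  shows "\<lbrakk>x \<in> carrier V; y \<in> carrier V\<rbrakk> \<Longrightarrow> B x y \<in> carrier F"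
    and "\<lbrakk>x \<in> carrier V; y \<in> carrier V; z \<in> carrier V\<rbrakk> \<Longrightarrow>
      B (x \<oplus>\<^bsub>A\<^esub> y) z = B x z \<oplus>\<^bsub>F\<^esub> B y z"
    and "\<lbrakk>x \<in> carrier V; y \<in> carrier V; z \<in> carrier V\<rbrakk> \<Longrightarrow>
      B x (y \<oplus>\<^bsub>A\<^esub> z) = B x y \<oplus>\<^bsub>F\<^esub> B x z"
    and "\<lbrakk>c \<in> carrier F; x \<in> carrier V; y \<in> carrier V\<rbrakk> \<Longrightarrow>
      B (c \<odot>\<^bsub>A\<^esub> x) y = c \<otimes>\<^bsub>F\<^esub> B x y"
    and "\<lbrakk>c \<in> carrier F; x \<in> carrier V; y \<in> carrier V\<rbrakk> \<Longrightarrow>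
      B x (c \<odot>\<^bsub>A\<^esub> y) = c \<otimes>\<^bsub>F\<^esub> B x y"
  using form_V by (simp_all add: bilinear_form_def)

private lemma form_balanced_left:
  assumes "y \<in> carrier V" "s \<in> carrier R"
  shows "V.balanced (add_monoid R) (\<lambda>x r. bf x r y s)"
  using assms
  by (intro V.balancedI)
    (simp_all add: B K.smult_l_distr K.smult_r_distr K.l_distr K.smult_assoc2 R.m_comm
      flip: K.smult_assoc1)

private lemma form_balanced_right:
  assumes "x \<in> carrier V" "r \<in> carrier R"
  shows "V.balanced (add_monoid R) (bf x r)"
  using assms
  by (intro V.balancedI)
    (simp_all add: B K.smult_l_distr K.smult_r_distr K.r_distr A.R_smult_mult R.m_comm
      flip: K.smult_assoc1)

lemma BR_closed: "\<lbrakk>u \<in> carrier VR; v \<in> carrier VR\<rbrakk> \<Longrightarrow> BR u v \<in> carrier R"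
  and BR_add_left: "\<lbrakk>u \<in> carrier VR; u' \<in> carrier VR; v \<in> carrier VR\<rbrakk> \<Longrightarrow>
    BR (u \<oplus>\<^bsub>VR\<^esub> u') v = BR u v \<oplus>\<^bsub>R\<^esub> BR u' v"
  and BR_add_right: "\<lbrakk>u \<in> carrier VR; v \<in> carrier VR; v' \<in> carrier VR\<rbrakk> \<Longrightarrow>
    BR u (v \<oplus>\<^bsub>VR\<^esub> v') = BR u v \<oplus>\<^bsub>R\<^esub> BR u v'"
  and BR_pure: "\<lbrakk>x \<in> carrier V; r \<in> carrier R; y \<in> carrier V; s \<in> carrier R\<rbrakk> \<Longrightarrow>
    BR (V.pure x r) (V.pure y s) = B x y \<odot>\<^bsub>R\<^esub> (r \<otimes>\<^bsub>R\<^esub> s)"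
  using V.bilift_closed[where f=bf, OF A.comm_group_add_R form_balanced_left form_balanced_right]
    V.bilift_add_left[where f=bf, OF A.comm_group_add_R form_balanced_left form_balanced_right]
    V.bilift_add_right[where f=bf, OF A.comm_group_add_R form_balanced_left form_balanced_right]
    V.bilift_pure[where f=bf, OF A.comm_group_add_R form_balanced_left form_balanced_right]
  by (simp_all add: extend_form_def)

lemma BR_bilinear: "bilinear_form R VR BR"
proof -
  have left: "BR (c \<odot>\<^bsub>VR\<^esub> u) v = c \<otimes>\<^bsub>R\<^esub> BR u v"
    and right: "BR u (c \<odot>\<^bsub>VR\<^esub> v) = c \<otimes>\<^bsub>R\<^esub> BR u v"
    if c: "c \<in> carrier R" and u: "u \<in> carrier VR" and v: "v \<in> carrier VR" for c u v
  proof -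
    show "BR (c \<odot>\<^bsub>VR\<^esub> u) v = c \<otimes>\<^bsub>R\<^esub> BR u v"
      using u v
      by (induction rule: V.tensor_induct2)
        (use c in \<open>simp_all add: BR_pure B A.R_smult_mult K.m_assoc BR_add_left BR_add_right
          V.smult_MR_add V.smult_MR_closed K.r_distr BR_closed\<close>)
    show "BR u (c \<odot>\<^bsub>VR\<^esub> v) = c \<otimes>\<^bsub>R\<^esub> BR u v"
      using u v
      by (induction rule: V.tensor_induct2)
        (use c in \<open>simp_all add: BR_pure B A.R_smult_mult K.m_lcomm BR_add_left BR_add_right
          V.smult_MR_add V.smult_MR_closed K.r_distr BR_closed\<close>)
  qed
  then show ?thesis
    by (simp add: bilinear_form_def BR_closed BR_add_left BR_add_right)
qed

end

text \<open>
  Both sides are additive in \<open>u\<close> and in \<open>v\<close>, so the coordinates of a product need to be compared for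
  pure tensors only, where they come from those in the algebra itself.
\<close>

lemma trR_mult:
  assumes "u \<in> carrier AR" "v \<in> carrier AR"
  shows "trR (u \<otimes>\<^bsub>AR\<^esub> v) = trR u \<otimes>\<^bsub>R\<^esub> trR v \<ominus>\<^bsub>R\<^esub> BR (prR u) (prR v)"
  using assms
proof (induction rule: A.tensor_induct2)
  case (pure x r y s)
  then show ?case
    by (simp add: mult_AR_pure trR_pure prR_pure amult_closed tr_mult BR_pure prD pr_closed trD
        a_minus_def K.smult_l_distr K.smult_l_minus B_closed V_A K.smult_assoc2 A.R_smult_mult
        R.m_comm flip: K.smult_assoc1)
next
  case (add_left u u' v)
  then show ?case
    by (simp add: mult_AR_add_left mult_AR_closed trRD prRD BR_add_left BR_closed K.l_distr
        a_minus_def K.minus_add K.add.m_ac)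
next
  case (add_right u v v')
  then show ?case
    by (simp add: mult_AR_add_right mult_AR_closed trRD prRD BR_add_right BR_closed K.r_distr
        a_minus_def K.minus_add K.add.m_ac)
qed

lemma prR_mult:
  assumes "u \<in> carrier AR" "v \<in> carrier AR"
  shows "prR (u \<otimes>\<^bsub>AR\<^esub> v) = trR u \<odot>\<^bsub>VR\<^esub> prR v \<oplus>\<^bsub>VR\<^esub> trR v \<odot>\<^bsub>VR\<^esub> prR u"
proof -
  interpret W: module R VR by (rule V.module_MR)
  interpret VF: module F V by (rule module_V)
  show ?thesis
    using assms
  proof (induction rule: A.tensor_induct2)
    case (pure x r y s)
    have c: "pr x \<in> carrier V" "pr y \<in> carrier V" "tr x \<in> carrier F" "tr y \<in> carrier F"
      using pure by (simp_all add: pr_closed trD)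
    have "prR (A.pure x r \<otimes>\<^bsub>AR\<^esub> A.pure y s) =
        V.pure (tr x \<odot>\<^bsub>V\<^esub> pr y \<oplus>\<^bsub>V\<^esub> tr y \<odot>\<^bsub>V\<^esub> pr x) (r \<otimes>\<^bsub>R\<^esub> s)"
      using pure by (simp add: mult_AR_pure prR_pure amult_closed pr_mult)
    also have "\<dots> = V.pure (pr y) (tr x \<odot>\<^bsub>R\<^esub> (r \<otimes>\<^bsub>R\<^esub> s)) \<oplus>\<^bsub>VR\<^esub>
        V.pure (pr x) (tr y \<odot>\<^bsub>R\<^esub> (r \<otimes>\<^bsub>R\<^esub> s))"
      using pure c
      by (simp add: V.pure_add_left V.pure_smult del: trace_zero_simps)
    also have "tr y \<odot>\<^bsub>R\<^esub> (r \<otimes>\<^bsub>R\<^esub> s) = (tr y \<odot>\<^bsub>R\<^esub> s) \<otimes>\<^bsub>R\<^esub> r"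
      using pure c K.smult_assoc2[of "tr y" s r] by (simp add: K.m_comm)
    finally show ?case
      using pure c by (simp add: trR_pure prR_pure K.smult_assoc2)
  next
    case (add_left u u' v)
    then show ?case
      by (simp add: mult_AR_add_left mult_AR_closed trRD prRD W.smult_l_distr W.smult_r_distr V.MR.a_ac)
  next
    case (add_right u v v')
    then show ?case
      by (simp add: mult_AR_add_right mult_AR_closed trRD prRD W.smult_l_distr W.smult_r_distr V.MR.a_ac)
  qed
qed

text \<open>
  This is the torsion-freeness hypothesis on \<open>V \<otimes> R\<close>.  For a nonzero vector \<open>e\<close> choose a functional \<open>l\<close> with \<open>l(e) = 1\<close>; its scalar
  extension maps \<open>c (e \<otimes> 1)\<close> to \<open>c\<close>.  Applied with \<open>c = s(e \<otimes> 1)\<close> this shows that \<open>s\<close> vanishes on the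
  generators \<open>e \<otimes> 1\<close>.
\<close>

lemma VR_functional_vanishes:
  assumes s: "linear_functional R VR s"
    and eq: "\<And>v. v \<in> carrier VR \<Longrightarrow> s v \<odot>\<^bsub>VR\<^esub> v = \<zero>\<^bsub>VR\<^esub>"
    and v: "v \<in> carrier VR"
  shows "s v = \<zero>\<^bsub>R\<^esub>"
proof -
  interpret W: module R VR by (rule V.module_MR)
  interpret VF: module F V by (rule module_V)
  note sD = linear_functionalD[OF s]
  have one: "s (V.pure e \<one>\<^bsub>R\<^esub>) = \<zero>\<^bsub>R\<^esub>" if e: "e \<in> carrier V" for e
  proof (cases "e = \<zero>\<^bsub>V\<^esub>")
    case True
    then show ?thesis
      using linear_functional_zero[OF s V.module_MR] by (simp del: trace_zero_simps)
  next
    case False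
    obtain l where l: "linear_functional F V l" "l e = \<one>\<^bsub>F\<^esub>"
      using exists_functional[OF module_V F.field_axioms e False] by blast
    note lD = linear_functionalD[OF l(1)]
    let ?L = "tensor_lift F V R (add_monoid R) (\<lambda>x r. l x \<odot>\<^bsub>R\<^esub> r)"
    have bal: "V.balanced (add_monoid R) (\<lambda>x r. l x \<odot>\<^bsub>R\<^esub> r)"
      by (rule V.balancedI)
        (simp_all add: lD K.smult_l_distr K.smult_r_distr R.m_comm del: trace_zero_simps flip: K.smult_assoc1)
    have L: "linear_functional R VR ?L"
      by (rule V.lift_linear_functional[OF bal]) (simp add: lD A.R_smult_mult)
    define c where "c = s (V.pure e \<one>\<^bsub>R\<^esub>)"
    have c: "c \<in> carrier R" using e by (simp add: c_def sD)
    have "\<zero>\<^bsub>VR\<^esub> = \<zero>\<^bsub>R\<^esub> \<odot>\<^bsub>VR\<^esub> V.pure e \<one>\<^bsub>R\<^esub>" using e by simp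
    then have "c \<odot>\<^bsub>VR\<^esub> V.pure e \<one>\<^bsub>R\<^esub> = \<zero>\<^bsub>R\<^esub> \<odot>\<^bsub>VR\<^esub> V.pure e \<one>\<^bsub>R\<^esub>"
      using eq[of "V.pure e \<one>\<^bsub>R\<^esub>"] e by (simp add: c_def)
    then have "c \<otimes>\<^bsub>R\<^esub> ?L (V.pure e \<one>\<^bsub>R\<^esub>) = \<zero>\<^bsub>R\<^esub> \<otimes>\<^bsub>R\<^esub> ?L (V.pure e \<one>\<^bsub>R\<^esub>)"
      using linear_functionalD(3)[OF L, of _ "V.pure e \<one>\<^bsub>R\<^esub>"] c e
      by (metis K.one_closed K.zero_closed V.pure_closed)
    then show ?thesis
      using c e by (simp add: V.lift_pure[OF A.comm_group_add_R bal] l(2) flip: c_def)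
  qed
  show ?thesis
    using v
  proof (induction rule: V.tensor_induct)
    case (pure x r)
    then have "s (V.pure x r) = r \<otimes>\<^bsub>R\<^esub> s (V.pure x \<one>\<^bsub>R\<^esub>)"
      using sD(3)[of r "V.pure x \<one>\<^bsub>R\<^esub>"] by simp
    then show ?case using pure one by simp
  qed (simp add: sD)
qed

lemma two_unit_R: "\<exists>h\<in>carrier R. h \<otimes>\<^bsub>R\<^esub> (\<one>\<^bsub>R\<^esub> \<oplus>\<^bsub>R\<^esub> \<one>\<^bsub>R\<^esub>) = \<one>\<^bsub>R\<^esub>"
proof
  let ?two = "\<one>\<^bsub>F\<^esub> \<oplus>\<^bsub>F\<^esub> \<one>\<^bsub>F\<^esub>"
  show "half \<odot>\<^bsub>R\<^esub> \<one>\<^bsub>R\<^esub> \<in> carrier R" using half by simp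
  have "\<one>\<^bsub>R\<^esub> \<oplus>\<^bsub>R\<^esub> \<one>\<^bsub>R\<^esub> = ?two \<odot>\<^bsub>R\<^esub> \<one>\<^bsub>R\<^esub>" by (simp add: K.smult_l_distr)
  then have "(half \<odot>\<^bsub>R\<^esub> \<one>\<^bsub>R\<^esub>) \<otimes>\<^bsub>R\<^esub> (\<one>\<^bsub>R\<^esub> \<oplus>\<^bsub>R\<^esub> \<one>\<^bsub>R\<^esub>) = (half \<otimes>\<^bsub>F\<^esub> ?two) \<odot>\<^bsub>R\<^esub> \<one>\<^bsub>R\<^esub>"
    using half(1) by (simp add: K.smult_assoc2 K.smult_assoc1)
  then show "(half \<odot>\<^bsub>R\<^esub> \<one>\<^bsub>R\<^esub>) \<otimes>\<^bsub>R\<^esub> (\<one>\<^bsub>R\<^esub> \<oplus>\<^bsub>R\<^esub> \<one>\<^bsub>R\<^esub>) = \<one>\<^bsub>R\<^esub>"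
    using half(2) by simp
qed

sublocale bfa: bilinear_form_algebra R AR VR trR prR incl BR
proof (intro bilinear_form_algebra.intro bilinear_form_algebra_axioms.intro)
  show "trR \<one>\<^bsub>AR\<^esub> = \<one>\<^bsub>R\<^esub>" by (simp add: one_AR trR_pure unity_closed tr_one)
  have "prR \<one>\<^bsub>AR\<^esub> = V.pure \<zero>\<^bsub>V\<^esub> \<one>\<^bsub>R\<^esub>"
    by (simp add: one_AR prR_pure unity_closed pr_one)
  then show "prR \<one>\<^bsub>AR\<^esub> = \<zero>\<^bsub>VR\<^esub>" by (simp del: trace_zero_simps)
qed (simp_all add: trR_functional prR_linear incl_linear one_AR unity_closed trR_incl prR_incl
    AR_decomposition[unfolded one_AR] BR_bilinear mult_AR_closed trR_mult prR_mult two_unit_R VR_functional_vanishes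
    A.module_MR V.module_MR)

lemma tensor_restriction_eq_res: "tensor_restriction F V A R = bfa.res"
  by (rule ext) (simp add: tensor_restriction_def bfa.res_def)

end


section \<open>Naturality\<close>

locale vidinli_extension_hom =
  R: vidinli_extension F A q R + S: vidinli_extension F A q S
  for F :: "('f, 'm) ring_scheme" (structure) and A :: "('f, 'a) module" (structure) and q
    and R :: "('f, 'r, 'k) module_scheme" (structure)
    and S :: "('f, 's, 'l) module_scheme" (structure) +
  fixes \<phi>
  assumes hom: "\<phi> \<in> algebra_hom F R S"
begin

sublocale HA: scalar_extension_hom F A R S \<phi>
  by (intro scalar_extension_hom.intro scalar_extension_hom_axioms.intro hom
      R.A.scalar_extension_axioms S.A.scalar_extension_axioms)

sublocale HV: scalar_extension_hom F R.V R S \<phi>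
  by (intro scalar_extension_hom.intro scalar_extension_hom_axioms.intro hom
      R.V.scalar_extension_axioms S.V.scalar_extension_axioms)

lemma scalar_map_incl:
  "v \<in> carrier R.VR \<Longrightarrow> HA.scalar_map (R.incl v) = S.incl (HV.scalar_map v)"
  by (induction rule: R.V.tensor_induct)
    (simp_all add: R.incl_pure HA.scalar_map_pure HV.scalar_map_pure R.V_A S.incl_pure HV.\<phi>_rules
      R.inclD HA.scalar_map_add HV.scalar_map_add HV.scalar_map_closed S.inclD)

text \<open>
  The inclusion of \<open>V \<otimes> S\<close> is injective, so it suffices to compare the two maps after it.  There both
  are additive and agree on pure tensors, as \<open>id \<otimes> \<phi>\<close> commutes with the inclusions.
\<close>

lemma restriction_natural:
  assumes g: "g \<in> carrier (algebra_aut_group R R.AR)"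
  shows "tensor_restriction F R.V A S (transition_map F A R S \<phi> g) =
    transition_map F R.V R S \<phi> (tensor_restriction F R.V A R g)"
proof -
  let ?h = "R.bfa.res g"
  have gl: "linear_map R R.AR R.AR g" using g by (simp add: carrier_algebra_aut_group)
  have hl: "linear_map R R.VR R.VR ?h"
    using R.bfa.res_isometry[OF g] by (simp add: carrier_isometry_group)
  note hD = linear_mapD[OF hl]
  have *: "S.incl (transition_map F R.V R S \<phi> ?h v) = transition_map F A R S \<phi> g (S.incl v)"
    if "v \<in> carrier S.VR" for v
    using that
  proof (induction rule: S.V.tensor_induct)
    case (pure x s)
    have c: "R.V.pure x \<one>\<^bsub>R\<^esub> \<in> carrier R.VR" using pure by simp
    have "S.incl (transition_map F R.V R S \<phi> ?h (S.V.pure x s)) =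
        s \<odot>\<^bsub>S.AR\<^esub> HA.scalar_map (R.incl (?h (R.V.pure x \<one>\<^bsub>R\<^esub>)))"
      using pure c by (simp add: HV.transition_pure[OF hl] S.inclD HV.scalar_map_closed hD scalar_map_incl)
    also have "\<dots> = transition_map F A R S \<phi> g (S.incl (S.V.pure x s))"
      using pure c
      by (simp add: R.bfa.j_res[OF g] R.incl_pure S.incl_pure HA.transition_pure[OF gl] R.V_A)
    finally show ?case .
  next
    case (add v w)
    then show ?case
      by (simp add: HV.transition_add[OF hl] HV.transition_closed[OF hl] S.inclD
          HA.transition_add[OF gl])
  qed
  show ?thesis
    unfolding R.tensor_restriction_eq_res
  proof (rule extensionalityI[of _ "carrier S.VR"])
    show "tensor_restriction F R.V A S (transition_map F A R S \<phi> g) \<in> extensional (carrier S.VR)"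
      by (simp add: tensor_restriction_def)
    show "transition_map F R.V R S \<phi> ?h \<in> extensional (carrier S.VR)"
      by (rule HV.transition_extensional[OF hl])
    fix v assume v: "v \<in> carrier S.VR"
    then show "tensor_restriction F R.V A S (transition_map F A R S \<phi> g) v =
        transition_map F R.V R S \<phi> ?h v"
      using inv_into_f_f[OF S.bfa.inj_j HV.transition_closed[OF hl v]]
      by (simp add: tensor_restriction_def *)
  qed
qed

end


section \<open>The isomorphism of group schemes\<close>

theorem theorem3p9:
  fixes F :: "'f ring" and A :: "('f, 'a) module" and q :: "'a \<Rightarrow> 'f"
  assumes vidinli: "vidinli_algebra F A q"
    and char_not_2: "\<one>\<^bsub>F\<^esub> \<oplus>\<^bsub>F\<^esub> \<one>\<^bsub>F\<^esub> \<noteq> \<zero>\<^bsub>F\<^esub>"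
  defines "V \<equiv> trace_zero F A q"
    and "B \<equiv> vidinli_form F A q"
  shows "(\<forall>R :: ('f, 'r) module. algebra F R \<longrightarrow>
            group (Aut_scheme F A R) \<and> group (Isom_scheme F V B R) \<and>
            tensor_restriction F V A R \<in> iso (Aut_scheme F A R) (Isom_scheme F V B R) \<and>
            (\<forall>g\<in>carrier (Aut_scheme F A R). \<forall>u\<in>carrier (base_change F V R).
               tensor_inclusion F V A R (tensor_restriction F V A R g u) =
               g (tensor_inclusion F V A R u))) \<and>
         (\<forall>(R :: ('f, 'r) module) (S :: ('f, 's) module) \<phi>.
            algebra F R \<longrightarrow> algebra F S \<longrightarrow> \<phi> \<in> algebra_hom F R S \<longrightarrow>
            (\<forall>g\<in>carrier (Aut_scheme F A R).
               tensor_restriction F V A S (transition_map F A R S \<phi> g) =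
               transition_map F V R S \<phi> (tensor_restriction F V A R g)))"
proof -
  interpret vidinli_algebra_char_not_2 F A q
    by (intro vidinli_algebra_char_not_2.intro vidinli_algebra_char_not_2_axioms.intro vidinli char_not_2)
  have ext: "vidinli_extension F A q R" if "algebra F R" for R :: "('f, 'x) module"
    using that by (intro vidinli_extension.intro vidinli_algebra_char_not_2_axioms)
  show ?thesis
    unfolding V_def B_def Aut_scheme_def Isom_scheme_def
  proof (intro conjI allI impI ballI)
    fix R :: "('f, 'r) module"
    assume "algebra F R"
    then interpret R: vidinli_extension F A q R by (rule ext)
    show "group (algebra_aut_group R R.AR)"
      by (rule group_algebra_aut_group[OF R.A.module_MR R.mult_AR_closed])
    show "group (isometry_group R R.VR R.BR)"
      by (rule group_isometry_group[OF R.V.module_MR])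
    show "tensor_restriction F (trace_zero F A q) A R \<in>
        iso (algebra_aut_group R R.AR) (isometry_group R R.VR R.BR)"
      unfolding R.tensor_restriction_eq_res by (rule R.bfa.res_iso)
    fix g u assume "g \<in> carrier (algebra_aut_group R R.AR)" "u \<in> carrier R.VR"
    then show "R.incl (tensor_restriction F (trace_zero F A q) A R g u) = g (R.incl u)"
      unfolding R.tensor_restriction_eq_res by (rule R.bfa.j_res)
  next
    fix R :: "('f, 'r) module" and S :: "('f, 's) module" and \<phi> g
    assume R: "algebra F R" and S: "algebra F S" and \<phi>: "\<phi> \<in> algebra_hom F R S"
      and g: "g \<in> carrier (algebra_aut_group R (base_change F A R))"
    interpret vidinli_extension_hom F A q R S \<phi>
      by (intro vidinli_extension_hom.intro vidinli_extension_hom_axioms.intro ext R S \<phi>)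
    show "tensor_restriction F (trace_zero F A q) A S (transition_map F A R S \<phi> g) =
        transition_map F (trace_zero F A q) R S \<phi> (tensor_restriction F (trace_zero F A q) A R g)"
      by (rule restriction_natural[OF g])
  qed
qed

end
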